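(* Let $Q$, $P$ and $Q_n,P_n$ ($n\ge 1$) be Borel probability measures on $\mathbb{R}^d$ with finite second moments. Assume that $Q$ has a positive density in the interior of its convex support, and that $\mathcal{W}_2(P_n,P)\to 0$ and $\mathcal{W}_2(Q_n,Q)\to 0$ as $n\to\infty$. For each $n$ let $\psi_n$ be an optimal transportation potential from $Q_n$ to $P_n$, and let $\psi$ be an optimal transportation potential from $Q$ to $P$. Then there exist constants $a_n\in\mathbb{R}$ such that, setting $\tilde\psi_n=\psi_n-a_n$, one has $\tilde\psi_n(x)\to\psi(x)$ for every $x$ in the interior of the support of $Q$, hence for $Q$-almost every $x$.
   Context: $\mathcal{W}_2^2(P,Q)$ is the minimum of $\int\|x-y\|^2\,d\pi(x,y)$ over Borel probabilities $\pi$ on $\mathbb{R}^d\times\mathbb{R}^d$ with marginals $P$ and $Q$. Convex functions on $\mathbb{R}^d$ take values in $(-\infty,+\infty]$, and $h^*(x)=\sup_{y}(x\cdot y-h(y))$ is the convex conjugate of $h$. For Borel probabilities $P,Q$ with finite second moments, let $\Phi$ be the set of pairs $(\varphi,\psi)\in L_1(P)\times L_1(Q)$ with $\varphi(x)+\psi(y)\ge x\cdot y$ for all $x,y\in\mathbb{R}^d$, and $J(\varphi,\psi)=\int\varphi\,dP+\int\psi\,dQ$. An optimal transportation potential from $Q$ to $P$ is a proper, lower semicontinuous, convex function $\psi$ such that $(\psi^*,\psi)\in\Phi$ minimizes $J$ over $\Phi$. "$Q$ has a positive density in the interior of its convex support" means that $Q$ is absolutely continuous with respect to Lebesgue measure,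 with a density that is strictly positive on the interior of the convex support of $Q$ (the smallest closed convex set of full $Q$-measure); in this case the support and the convex support of $Q$ coincide. *)

theory Defs
  imports "HOL-Probability.Probability"
begin

definition borel_prob :: "'a::topological_space measure \<Rightarrow> bool" where
  "borel_prob M \<longleftrightarrow> prob_space M \<and> sets M = sets borel"

definition finite_second_moment :: "'a::euclidean_space measure \<Rightarrow> bool" where
  "finite_second_moment M \<longleftrightarrow> integrable M (\<lambda>x. (norm x)\<^sup>2)"

definition couplings ::
  "'a::euclidean_space measure \<Rightarrow> 'a measure \<Rightarrow> ('a \<times> 'a) measure set" where
  "couplings P Q = {\<pi>. borel_prob \<pi> \<and> distr \<pi> borel fst = P \<and> distr \<pi> borel snd = Q}"

(* The infimum is attained for all Borel probabilities, so it is the minimum. *)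
definition wasserstein2_sq ::
  "'a::euclidean_space measure \<Rightarrow> 'a measure \<Rightarrow> ennreal" where
  "wasserstein2_sq P Q =
     (INF \<pi>\<in>couplings P Q. \<integral>\<^sup>+ (x, y). ennreal ((norm (x - y))\<^sup>2) \<partial>\<pi>)"

(* wasserstein2_sq P Q is finite whenever P and Q have finite second moments (use the
   product coupling), so enn2real loses nothing there; it maps an infinite cost to 0. *)
definition wasserstein2 ::
  "'a::euclidean_space measure \<Rightarrow> 'a measure \<Rightarrow> real" where
  "wasserstein2 P Q = sqrt (enn2real (wasserstein2_sq P Q))"

definition convex_fun :: "('a::real_vector \<Rightarrow> ereal) \<Rightarrow> bool" where
  "convex_fun f \<longleftrightarrow> (\<forall>x. f x \<noteq> -\<infinity>) \<and>
     (\<forall>x y t. 0 < t \<and> t < 1 \<longrightarrow>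
        f ((1 - t) *\<^sub>R x + t *\<^sub>R y) \<le> ereal (1 - t) * f x + ereal t * f y)"

definition proper_fun :: "('a \<Rightarrow> ereal) \<Rightarrow> bool" where
  "proper_fun f \<longleftrightarrow> (\<forall>x. f x \<noteq> -\<infinity>) \<and> (\<exists>x. f x \<noteq> \<infinity>)"

definition lsc_fun :: "('a::topological_space \<Rightarrow> ereal) \<Rightarrow> bool" where
  "lsc_fun f \<longleftrightarrow> (\<forall>x. f x \<le> Liminf (at x) f)"

definition conjugate :: "('a::real_inner \<Rightarrow> ereal) \<Rightarrow> 'a \<Rightarrow> ereal" where
  "conjugate h x = (SUP y. ereal (x \<bullet> y) - h y)"

(* Members of L1 may take infinite values on a null set; the integral of such a function
   is therefore the Bochner integral of its real part. *)
definition L1 :: "'a measure \<Rightarrow> ('a \<Rightarrow> ereal) set" where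
  "L1 M = {f \<in> borel_measurable M. (\<integral>\<^sup>+ x. e2ennreal \<bar>f x\<bar> \<partial>M) < \<infinity>}"

definition L1_integral :: "'a measure \<Rightarrow> ('a \<Rightarrow> ereal) \<Rightarrow> real" where
  "L1_integral M f = (\<integral>x. real_of_ereal (f x) \<partial>M)"

(* In ereal \<infinity> + -\<infinity> = \<infinity>, but this case does not arise for a dual pair: if
   \<phi> x = -\<infinity> for some x, the inequality forces \<psi> = \<infinity> everywhere, so \<psi> is not in L1 Q,
   and symmetrically.  Hence both functions take values in (-\<infinity>, \<infinity>]. *)
definition dual_pairs ::
  "'a::euclidean_space measure \<Rightarrow> 'a measure \<Rightarrow> (('a \<Rightarrow> ereal) \<times> ('a \<Rightarrow> ereal)) set" where
  "dual_pairs P Q =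
     {(\<phi>, \<psi>). \<phi> \<in> L1 P \<and> \<psi> \<in> L1 Q \<and> (\<forall>x y. \<phi> x + \<psi> y \<ge> ereal (x \<bullet> y))}"

definition dual_cost ::
  "'a::euclidean_space measure \<Rightarrow> 'a measure \<Rightarrow> ('a \<Rightarrow> ereal) \<Rightarrow> ('a \<Rightarrow> ereal) \<Rightarrow> real" where
  "dual_cost P Q \<phi> \<psi> = L1_integral P \<phi> + L1_integral Q \<psi>"

(* Argument order: the potential goes from Q to P, and \<psi> is integrated against Q. *)
definition optimal_potential ::
  "'a::euclidean_space measure \<Rightarrow> 'a measure \<Rightarrow> ('a \<Rightarrow> ereal) \<Rightarrow> bool" where
  "optimal_potential Q P \<psi> \<longleftrightarrow>
     proper_fun \<psi> \<and> lsc_fun \<psi> \<and> convex_fun \<psi> \<and>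
     (conjugate \<psi>, \<psi>) \<in> dual_pairs P Q \<and>
     (\<forall>(f, g)\<in>dual_pairs P Q. dual_cost P Q (conjugate \<psi>) \<psi> \<le> dual_cost P Q f g)"

(* Intended for Borel probabilities.  The space is second countable, so the intersections
   below again have full measure: they are the smallest closed (closed convex) sets of
   full measure. *)
definition measure_support :: "'a::euclidean_space measure \<Rightarrow> 'a set" where
  "measure_support M = \<Inter>{C. closed C \<and> emeasure M C = 1}"

definition convex_support :: "'a::euclidean_space measure \<Rightarrow> 'a set" where
  "convex_support M = \<Inter>{C. closed C \<and> convex C \<and> emeasure M C = 1}"

definition has_positive_density :: "'a::euclidean_space measure \<Rightarrow> bool" where
  "has_positive_density Q \<longleftrightarrow>
     (\<exists>f\<in>borel_measurable lborel. (\<forall>x. 0 \<le> f x) \<and>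
        Q = density lborel (\<lambda>x. ennreal (f x)) \<and>
        (\<forall>x\<in>interior (convex_support Q). 0 < f x))"

end

theory Submission
  imports Defs
begin

text \<open>
  The argument stays within the dual problem; couplings serve only to compare integrals with respect
  to nearby measures. Let \<open>U\<close> be the interior of the support of \<open>Q\<close>, \<open>J\<close> the cost of dual pairs
  for \<open>(P, Q)\<close>, and write \<open>\<phi>\<close>, \<open>\<phi>n\<close> for the conjugates of \<open>\<psi>\<close>, \<open>\<psi>n\<close>. Three ideas carry the proof.

  A dual pair survives a small perturbation of the measures. Replacing both functions of a pair by
  their quadratic envelopes (\<open>quad_env\<close>) gives functions of at most quadratic growth that still form a
  dual pair, and, because the infimum in the envelope may be tested along any coupling, the cost
  increases by at most (transport cost) / \<open>e\<close> + \<open>O(e)\<close> (\<open>quad_env_dual_pair\<close>). Applied in both directions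
  this shows that the minimal costs for \<open>(Pn, Qn)\<close> converge to the minimal cost for \<open>(P, Q)\<close>, so the
  envelopes of \<open>(\<phi>n, \<psi>n)\<close> are near-minimizers of \<open>J\<close>. Moreover a point where the envelopes nearly attain
  equality in \<open>f x + g y \<ge> x \<bullet> y\<close> lies close to one where the original pair does
  (\<open>quad_env_contact\<close>).

  Two near-minimizers touch together. If \<open>(F, G)\<close> is a near-minimizer, then so is its midpoint with
  \<open>(\<phi>, \<psi>)\<close>, and replacing the second component by the conjugate \<open>h\<close> of \<open>(F + \<phi>) / 2\<close> cannot lower \<open>J\<close>
  below its minimum. Hence \<open>(G + \<psi>) / 2 - h\<close> is nonnegative with small \<open>Q\<close>-integral, and in every ball
  of positive measure there is a point where it is small: there one and the same \<open>x\<close> is an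
  approximate subgradient of \<open>G\<close> and of \<open>\<psi>\<close> (\<open>near_minimizers_touch_together\<close>). Consequently, near every
  point of \<open>U\<close>, the functions \<open>\<psi>n\<close> and \<open>\<psi>\<close> have almost equal approximate subgradients once \<open>n\<close> is large
  (\<open>nearby_potentials_share_subgradient\<close>).

  Shared subgradients determine a convex function up to a constant. Along a segment cut into \<open>N\<close>
  pieces, the subgradient inequalities for \<open>\<psi>n\<close> forwards and for \<open>\<psi>\<close> backwards telescope, and the
  increment of \<open>\<psi>n - \<psi>\<close> is eventually \<open>O(1 / N)\<close> (\<open>difference_along_segment\<close>). Convexity of \<open>\<psi>n\<close> passes from the
  nearby points where subgradients are available to the given point (\<open>difference_at_points\<close>), so
  \<open>\<psi>n - \<psi>\<close> becomes constant on \<open>U\<close> in the limit and the constants \<open>a n\<close> may be read off at one base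
  point (\<open>convergence_from_shared_subgradients\<close>).

  The positive density enters through \<open>interior_support_positive_density\<close>: \<open>U\<close> is convex and of full
  measure, and every nonempty open subset of \<open>U\<close> has positive measure.
\<close>

section \<open>Convex functions with extended values\<close>

lemma convex_sublevel:
  fixes f :: "'a::real_vector \<Rightarrow> ereal"
  assumes "convex_fun f"
  shows "convex {z. f z \<le> ereal c}"
proof (rule convexI)
  fix x y :: 'a and s t :: real
  assume *: "x \<in> {z. f z \<le> ereal c}" "y \<in> {z. f z \<le> ereal c}" "0 \<le> s" "0 \<le> t" "s + t = 1"
  then have s: "s = 1 - t" by simp
  consider "t = 0" | "t = 1" | "0 < t" "t < 1" using * by linarith
  then show "s *\<^sub>R x + t *\<^sub>R y \<in> {z. f z \<le> ereal c}"
  proof cases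
    case 3
    have "f ((1 - t) *\<^sub>R x + t *\<^sub>R y) \<le> ereal (1 - t) * f x + ereal t * f y"
      using assms 3 by (auto simp: convex_fun_def)
    also have "\<dots> \<le> ereal (1 - t) * ereal c + ereal t * ereal c"
      using * 3 by (intro add_mono ereal_mult_left_mono) auto
    also have "\<dots> = ereal c" by (simp add: algebra_simps)
    finally show ?thesis by (simp add: s)
  qed (use * s in auto)
qed

lemma convex_finite_domain:
  fixes f :: "'a::real_vector \<Rightarrow> ereal"
  assumes "convex_fun f"
  shows "convex {z. f z \<noteq> \<infinity>}"
proof (rule convexI)
  fix x y :: 'a and s t :: real
  assume *: "x \<in> {z. f z \<noteq> \<infinity>}" "y \<in> {z. f z \<noteq> \<infinity>}" "0 \<le> s" "0 \<le> t" "s + t = 1"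
  from assms * obtain a b where ab: "f x = ereal a" "f y = ereal b"
    by (cases "f x"; cases "f y") (auto simp: convex_fun_def)
  have "s *\<^sub>R x + t *\<^sub>R y \<in> {z. f z \<le> ereal (max a b)}"
    using convexD[OF convex_sublevel[OF assms, of "max a b"], of x y s t] * ab by auto
  then show "s *\<^sub>R x + t *\<^sub>R y \<in> {z. f z \<noteq> \<infinity>}"
    by (auto simp del: ereal_max)
qed

lemma convex_on_real_of_convex_fun:
  fixes f :: "'a::real_vector \<Rightarrow> ereal"
  assumes "convex_fun f" "convex U" "\<And>x. x \<in> U \<Longrightarrow> f x = ereal (p x)"
  shows "convex_on U p"
proof (rule convex_onI)
  fix t x y assume t: "0 < (t::real)" "t < 1" and xy: "x \<in> U" "y \<in> U"
  have "(1 - t) *\<^sub>R x + t *\<^sub>R y \<in> U"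
    using t xy assms(2) by (intro convexD) auto
  moreover have "f ((1 - t) *\<^sub>R x + t *\<^sub>R y) \<le> ereal (1 - t) * f x + ereal t * f y"
    using assms(1) t by (auto simp: convex_fun_def)
  ultimately show "p ((1 - t) *\<^sub>R x + t *\<^sub>R y) \<le> (1 - t) * p x + t * p y"
    using xy assms(3) by simp
qed (use assms in auto)

section \<open>Shared approximate subgradients force convergence\<close>

text \<open>
  A point is the centre of the cross-polytope with vertices \<open>y \<plusminus> s *\<^sub>R b\<close>, and stays in its hull when
  the vertices move a little. Otherwise a hyperplane with normal \<open>a\<close> would have all perturbed vertices
  strictly on one side of \<open>y\<close>; the vertices opposite to \<open>a\<close> then bound every coordinate of \<open>a\<close> by
  \<open>norm a / (2 * DIM('a))\<close>, which is too small for their absolute sum to reach \<open>norm a\<close>.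
\<close>

lemma mem_convex_hull_perturbed_cross:
  fixes y :: "'a::euclidean_space" and w :: "'a \<Rightarrow> real \<Rightarrow> 'a"
  assumes "0 < s"
    and w: "\<And>b t. b \<in> Basis \<Longrightarrow> t \<in> {-1, 1} \<Longrightarrow>
      norm (w b t - (y + (t * s) *\<^sub>R b)) < s / (2 * DIM('a))"
  shows "y \<in> convex hull {w b t | b t. b \<in> Basis \<and> t \<in> {-1, 1}}" (is "y \<in> convex hull ?W")
proof (rule ccontr)
  assume "y \<notin> convex hull ?W"
  have W: "?W = (\<lambda>(b, t). w b t) ` (Basis \<times> {-1, 1})" by auto
  have fin: "finite ?W" unfolding W by (intro finite_imageI finite_cartesian_product) auto
  then have "compact (convex hull ?W)" by (intro compact_convex_hull finite_imp_compact)
  then have "closed (convex hull ?W)" by (rule compact_imp_closed)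
  from separating_hyperplane_closed_point[OF convex_convex_hull this \<open>y \<notin> _\<close>]
  obtain a c where ac: "a \<bullet> y < c" "\<forall>x\<in>convex hull ?W. c < a \<bullet> x" by auto
  have "b \<in> Basis \<Longrightarrow> \<bar>a \<bullet> b\<bar> \<le> norm a / (2 * DIM('a))" for b
  proof -
    assume b: "b \<in> Basis"
    define t :: real where "t = (if a \<bullet> b \<ge> 0 then -1 else 1)"
    have t: "t \<in> {-1, 1}" by (auto simp: t_def)
    have "w b t \<in> convex hull ?W" using b t by (intro hull_inc) auto
    then have "a \<bullet> y < a \<bullet> w b t" using ac by (meson less_trans)
    also have "a \<bullet> w b t = a \<bullet> y + s * (t * (a \<bullet> b)) + a \<bullet> (w b t - (y + (t * s) *\<^sub>R b))"
      by (simp add: algebra_simps inner_diff_right inner_add_right)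
    also have "t * (a \<bullet> b) = - \<bar>a \<bullet> b\<bar>" by (auto simp: t_def)
    finally have "s * \<bar>a \<bullet> b\<bar> < a \<bullet> (w b t - (y + (t * s) *\<^sub>R b))" by simp
    also have "\<dots> \<le> norm a * norm (w b t - (y + (t * s) *\<^sub>R b))" by (rule norm_cauchy_schwarz)
    also have "\<dots> \<le> norm a * (s / (2 * DIM('a)))"
      using w[OF b t] by (intro mult_left_mono) auto
    finally have "s * \<bar>a \<bullet> b\<bar> \<le> s * (norm a / (2 * DIM('a)))" by (simp add: algebra_simps)
    then show ?thesis using \<open>0 < s\<close> by (simp only: mult_le_cancel_left_pos)
  qed
  then have "(\<Sum>b\<in>Basis. \<bar>a \<bullet> b\<bar>) \<le> (\<Sum>b\<in>(Basis::'a set). norm a / (2 * DIM('a)))"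
    by (intro sum_mono) auto
  also have "\<dots> = norm a / 2" by simp
  finally have "norm a \<le> norm a / 2" using norm_le_l1[of a] by linarith
  then have "a = 0" by simp
  obtain b :: 'a where "b \<in> Basis" using nonempty_Basis by blast
  then have "w b 1 \<in> convex hull ?W" by (intro hull_inc) auto
  with ac \<open>a = 0\<close> show False by fastforce
qed

text \<open>
  The telescoping estimate. The points \<open>w k\<close> and \<open>v k\<close> lie near the equidistant points
  \<open>y + real k *\<^sub>R d\<close>; \<open>c\<close> increases at least as fast as the subgradients \<open>u k\<close> of the left end points
  allow, \<open>q\<close> at most as fast as the subgradients \<open>x (Suc k)\<close> of the right end points allow. Up to errors
  of order \<open>r\<close> one step contributes \<open>(x k - x (Suc k)) \<bullet> d\<close>, and these terms cancel except for the first
  and the last. Since \<open>d\<close> is the total displacement divided by the number of steps, what remains is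
  small.
\<close>

lemma chained_approximate_subgradients:
  fixes w v u x :: "nat \<Rightarrow> 'a::euclidean_space" and c q :: "nat \<Rightarrow> real"
  assumes r: "0 \<le> r" "r \<le> 1" and "0 \<le> L" "\<And>k. k \<le> N \<Longrightarrow> norm (x k) \<le> L"
    and w: "\<And>k. k \<le> N \<Longrightarrow> norm (w k - (y + real k *\<^sub>R d)) \<le> r"
    and v: "\<And>k. k \<le> N \<Longrightarrow> norm (v k - (y + real k *\<^sub>R d)) \<le> r"
    and ux: "\<And>k. k \<le> N \<Longrightarrow> norm (u k - x k) \<le> r"
    and cs: "\<And>k. Suc k \<le> N \<Longrightarrow> c k + u k \<bullet> (w (Suc k) - w k) - r \<le> c (Suc k)"
    and qs: "\<And>k. Suc k \<le> N \<Longrightarrow> q (Suc k) + x (Suc k) \<bullet> (v k - v (Suc k)) - r \<le> q k"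
    and "m \<le> N"
  shows "(x 0 - x m) \<bullet> d - 2 * real m * (norm d + 2 * L + 3) * r \<le> (c m - c 0) - (q m - q 0)"
  using \<open>m \<le> N\<close>
proof (induction m)
  case (Suc m)
  have dist2: "norm (f (Suc m) - f m - d) \<le> 2 * r"
    if f: "\<And>k. k \<le> N \<Longrightarrow> norm (f k - (y + real k *\<^sub>R d)) \<le> r" for f :: "nat \<Rightarrow> 'a"
  proof -
    have "f (Suc m) - f m - d = (f (Suc m) - (y + real (Suc m) *\<^sub>R d)) - (f m - (y + real m *\<^sub>R d))"
      by (simp add: algebra_simps)
    then have "norm (f (Suc m) - f m - d) \<le>
        norm (f (Suc m) - (y + real (Suc m) *\<^sub>R d)) + norm (f m - (y + real m *\<^sub>R d))"
      using norm_triangle_ineq4 by metis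
    then show ?thesis using f[of m] f[of "Suc m"] Suc.prems by linarith
  qed
  have bound: "\<bar>a \<bullet> b - x k \<bullet> d\<bar> \<le> (norm d + 2) * r + 2 * L * r"
    if "k \<le> N" "norm (a - x k) \<le> r" "norm (b - d) \<le> 2 * r" for a b k
  proof -
    have "norm b \<le> norm d + 2" using norm_triangle_ineq[of d "b - d"] that r by simp
    have "a \<bullet> b - x k \<bullet> d = (a - x k) \<bullet> b + x k \<bullet> (b - d)" by (simp add: algebra_simps)
    also have "\<bar>\<dots>\<bar> \<le> \<bar>(a - x k) \<bullet> b\<bar> + \<bar>x k \<bullet> (b - d)\<bar>" by (rule abs_triangle_ineq)
    also have "\<dots> \<le> norm (a - x k) * norm b + norm (x k) * norm (b - d)"
      by (intro add_mono Cauchy_Schwarz_ineq2)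
    also have "\<dots> \<le> r * (norm d + 2) + L * (2 * r)"
      using that assms \<open>norm b \<le> norm d + 2\<close> by (intro add_mono mult_mono) auto
    finally show ?thesis by (simp add: algebra_simps)
  qed
  have "\<bar>u m \<bullet> (w (Suc m) - w m) - x m \<bullet> d\<bar> \<le> (norm d + 2) * r + 2 * L * r"
    using Suc.prems ux dist2[OF w] by (intro bound) auto
  moreover have "\<bar>x (Suc m) \<bullet> (v (Suc m) - v m) - x (Suc m) \<bullet> d\<bar> \<le> (norm d + 2) * r + 2 * L * r"
    using Suc.prems r dist2[OF v] by (intro bound) auto
  moreover have "x (Suc m) \<bullet> (v m - v (Suc m)) = - (x (Suc m) \<bullet> (v (Suc m) - v m))"
    by (simp add: inner_diff_right)
  moreover note cs[OF Suc.prems] qs[OF Suc.prems]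
  moreover have "(x 0 - x m) \<bullet> d - 2 * real m * (norm d + 2 * L + 3) * r \<le> (c m - c 0) - (q m - q 0)"
    using Suc by simp
  ultimately show ?case by (simp add: algebra_simps)
qed simp

lemma approximate_subgradient_bound:
  fixes p :: "'a::euclidean_space \<Rightarrow> real"
  assumes "0 < r" "\<And>z. z \<in> cball v r \<Longrightarrow> \<bar>p z\<bar> \<le> M"
    and sub: "\<And>z. z \<in> cball v r \<Longrightarrow> p v + x \<bullet> (z - v) - d \<le> p z"
  shows "norm x \<le> (2 * M + d) / r"
proof (cases "x = 0")
  case True
  have "\<bar>p v\<bar> \<le> M" "- d \<le> 0" using assms(1,2) sub[of v] by auto
  then show ?thesis using \<open>0 < r\<close> True by auto
next
  case False
  define z where "z = v + (r / norm x) *\<^sub>R x"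
  have "z \<in> cball v r" using \<open>0 < r\<close> False by (simp add: z_def dist_norm)
  moreover have "x \<bullet> (z - v) = r * norm x"
    using False by (simp add: z_def dot_square_norm power2_eq_square)
  moreover have "\<bar>p z\<bar> \<le> M" "\<bar>p v\<bar> \<le> M" using assms(1,2) \<open>z \<in> _\<close> by auto
  ultimately have "r * norm x \<le> 2 * M + d" using sub[of z] by linarith
  then show ?thesis using \<open>0 < r\<close> by (simp add: field_simps)
qed

text \<open>
  The approximate subgradients \<open>u\<close> of \<open>f\<close> and \<open>x\<close> of \<open>p\<close> are taken at different points \<open>w\<close> and \<open>v\<close> and are
  only nearly equal, because this is the form in which they arise after undoing the quadratic
  envelope. A single tolerance \<open>r\<close> measures all the errors.
\<close>

definition share_subgradient_near ::
  "('a::euclidean_space \<Rightarrow> ereal) \<Rightarrow> ('a \<Rightarrow> real) \<Rightarrow> 'a set \<Rightarrow> real \<Rightarrow> 'a \<Rightarrow> bool" where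
  "share_subgradient_near f p U r y \<longleftrightarrow>
     (\<exists>w v u x c. norm (w - y) < r \<and> norm (v - y) < r \<and> norm (u - x) < r \<and> f w = ereal c \<and>
        (\<forall>z. ereal (c + u \<bullet> (z - w) - r) \<le> f z) \<and>
        (\<forall>z\<in>U. p v + x \<bullet> (z - v) - r \<le> p z))"

text \<open>
  The target point \<open>z\<close> is exact, whereas at the other end a point \<open>w\<close> near \<open>y\<close> has to be accepted:
  an approximate subgradient of \<open>f n\<close> bounds \<open>f n z\<close> from below, but it gives no upper bound for the
  value of \<open>f n\<close> at a prescribed point.
\<close>

lemma difference_along_segment:
  fixes f :: "nat \<Rightarrow> 'a::euclidean_space \<Rightarrow> ereal"
  assumes U: "open U" "convex U" and p: "continuous_on U p"
    and share: "\<And>y r. y \<in> U \<Longrightarrow> 0 < r \<Longrightarrow> \<forall>\<^sub>F n in sequentially. share_subgradient_near (f n) p U r y"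
    and yz: "y \<in> U" "z \<in> U" and "0 < \<theta>" "0 < s"
  shows "\<forall>\<^sub>F n in sequentially. \<exists>w c. norm (w - y) < s \<and> f n w = ereal c \<and>
      ereal (c - p y + p z - \<theta>) \<le> f n z"
proof -
  define S where "S = closed_segment y z"
  have "S \<subseteq> U" using U yz by (simp add: S_def closed_segment_subset)
  moreover have "compact S" by (simp add: S_def)
  ultimately obtain r0 where r0: "0 < r0" "(\<Union>a\<in>S. cball a r0) \<subseteq> U"
    using compact_subset_open_imp_cball_epsilon_subset U(1) by blast
  define K where "K = (\<Union>a\<in>S. cball a r0)"
  have "compact K" unfolding K_def using \<open>compact S\<close>
    by (intro compact_minkowski_sum_cball)
  moreover have "K \<subseteq> U" using r0 by (simp add: K_def)
  ultimately have "bounded (p ` K)"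
    by (intro compact_imp_bounded compact_continuous_image continuous_on_subset[OF p])
  then obtain M where M: "\<And>a. a \<in> K \<Longrightarrow> \<bar>p a\<bar> \<le> M"
    unfolding bounded_iff by auto
  have "y \<in> S" "z \<in> S" by (auto simp: S_def)
  have SK: "a \<in> K" if "a \<in> S" for a using that r0(1) by (auto simp: K_def intro!: bexI[of _ a])
  have "0 \<le> M" using M[OF SK[OF \<open>y \<in> S\<close>]] by linarith
  (* Points within R of the segment still have a ball of radius R inside K, on which p is bounded
     by M; this bounds every approximate subgradient at such a point by L. *)
  define R where "R = r0 / 2"
  have "0 < R" using r0 by (simp add: R_def)
  have cballK: "cball v R \<subseteq> K" if "a \<in> S" "norm (v - a) \<le> R" for v a
  proof
    fix b assume "b \<in> cball v R"
    then have "dist a b \<le> r0"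
      using that dist_triangle[of a b v] by (simp add: R_def dist_norm norm_minus_commute)
    then show "b \<in> K" using that by (auto simp: K_def)
  qed
  define L where "L = (2 * M + 1) / R"
  have "0 \<le> L" using \<open>0 \<le> M\<close> \<open>0 < R\<close> by (simp add: L_def)
  (* The telescoped sum leaves 2 * L * norm d, so the number N of pieces is chosen first; only then
     is the tolerance r fixed, since the accumulated error is of order N * r. *)
  obtain N :: nat where N: "8 * L * norm (z - y) / \<theta> < real N" using reals_Archimedean2 by blast
  have "0 \<le> 8 * L * norm (z - y) / \<theta>" using \<open>0 \<le> L\<close> \<open>0 < \<theta>\<close> by simp
  with N have "0 < real N" by linarith
  define d where "d = (1 / real N) *\<^sub>R (z - y)"
  have "norm d = norm (z - y) / real N" by (simp only: d_def norm_scaleR) simp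
  then have d: "2 * L * norm d \<le> \<theta> / 4"
  proof -
    have "8 * L * norm (z - y) < \<theta> * real N" using N \<open>0 < \<theta>\<close> by (simp add: field_simps)
    moreover have "norm (z - y) = norm d * real N"
      using \<open>norm d = _\<close> \<open>0 < real N\<close> by simp
    ultimately have "(8 * L * norm d) * real N < \<theta> * real N" by (simp add: mult.assoc)
    then have "8 * L * norm d < \<theta>" using \<open>0 < real N\<close> by (simp only: mult_less_cancel_right_pos)
    then show ?thesis by simp
  qed
  have "y + real N *\<^sub>R d = z" using \<open>0 < real N\<close> by (simp add: d_def)
  have onS: "y + real k *\<^sub>R d \<in> S" if "k \<le> N" for k
  proof -
    have "y + real k *\<^sub>R d = (1 - real k / real N) *\<^sub>R y + (real k / real N) *\<^sub>R z"
      by (simp add: d_def algebra_simps)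
    moreover have "0 \<le> real k / real N" "real k / real N \<le> 1"
      using that \<open>0 < real N\<close> by auto
    ultimately show ?thesis unfolding S_def closed_segment_def by blast
  qed
  have cont: "\<exists>e>0. \<forall>b. norm (b - a) < e \<longrightarrow> \<bar>p b - p a\<bar> < \<theta> / 8" if "a \<in> U" for a
  proof -
    have "isCont p a" using p U(1) that by (simp add: continuous_on_eq_continuous_at)
    then have "\<exists>e>0. \<forall>b. dist b a < e \<longrightarrow> dist (p b) (p a) < \<theta> / 8"
      using \<open>0 < \<theta>\<close> unfolding continuous_at_eps_delta
      by (meson divide_pos_pos zero_less_numeral)
    then show ?thesis by (simp add: dist_norm)
  qed
  obtain ey where ey: "0 < ey" "\<And>b. norm (b - y) < ey \<Longrightarrow> \<bar>p b - p y\<bar> < \<theta> / 8"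
    using cont[OF yz(1)] by blast
  obtain ez where ez: "0 < ez" "\<And>b. norm (b - z) < ez \<Longrightarrow> \<bar>p b - p z\<bar> < \<theta> / 8"
    using cont[OF yz(2)] by blast
  define A where "A = 2 * real N * (norm d + 2 * L + 3)"
  have "0 < A" using \<open>0 < real N\<close> \<open>0 \<le> L\<close> by (auto simp: A_def intro!: mult_pos_pos add_nonneg_pos)
  define r where "r = Min {1, R, s, ey, ez, \<theta> / 4 / A, \<theta> / 4 / (L + 2)}"
  have "0 < r" using \<open>0 < R\<close> \<open>0 < s\<close> ey(1) ez(1) \<open>0 < \<theta>\<close> \<open>0 < A\<close> \<open>0 \<le> L\<close>
    by (auto simp: r_def)
  have "r \<le> a" if "a \<in> {1, R, s, ey, ez, \<theta> / 4 / A, \<theta> / 4 / (L + 2)}" for a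
    unfolding r_def using that by (intro Min_le) auto
  then have r: "r \<le> 1" "r \<le> R" "r \<le> s" "r \<le> ey" "r \<le> ez" "r \<le> \<theta> / 4 / A" "r \<le> \<theta> / 4 / (L + 2)"
    by blast+
  have rA: "A * r \<le> \<theta> / 4" using r(6) \<open>0 < A\<close> by (simp add: field_simps)
  have rL: "(L + 2) * r \<le> \<theta> / 4" using r(7) \<open>0 \<le> L\<close> by (simp add: field_simps)
  have "\<forall>\<^sub>F n in sequentially. \<forall>k\<in>{..N}. share_subgradient_near (f n) p U r (y + real k *\<^sub>R d)"
    using onS \<open>S \<subseteq> U\<close> \<open>0 < r\<close> by (intro eventually_ball_finite ballI share) auto
  then show ?thesis
  proof eventually_elim
    case (elim n)
    then have "\<forall>k. \<exists>w v u x c. k \<le> N \<longrightarrow>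
        norm (w - (y + real k *\<^sub>R d)) < r \<and> norm (v - (y + real k *\<^sub>R d)) < r \<and> norm (u - x) < r \<and>
        f n w = ereal c \<and> (\<forall>z. ereal (c + u \<bullet> (z - w) - r) \<le> f n z) \<and>
        (\<forall>z\<in>U. p v + x \<bullet> (z - v) - r \<le> p z)"
      unfolding share_subgradient_near_def by blast
    then obtain w v u x c where *: "\<And>k. k \<le> N \<Longrightarrow>
        norm (w k - (y + real k *\<^sub>R d)) < r \<and> norm (v k - (y + real k *\<^sub>R d)) < r \<and>
        norm (u k - x k) < r \<and>
        f n (w k) = ereal (c k) \<and> (\<forall>z. ereal (c k + u k \<bullet> (z - w k) - r) \<le> f n z) \<and>
        (\<forall>z\<in>U. p (v k) + x k \<bullet> (z - v k) - r \<le> p z)"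
      by metis
    have vK: "cball (v k) R \<subseteq> K" if "k \<le> N" for k
      using cballK[OF onS[OF that], of "v k"] *[OF that] r(2) by auto
    have vU: "v k \<in> U" if "k \<le> N" for k
      using subsetD[OF vK[OF that], of "v k"] \<open>K \<subseteq> U\<close> \<open>0 < R\<close> by auto
    have xL: "norm (x k) \<le> L" if "k \<le> N" for k
    proof -
      have "z \<in> K" "z \<in> U" if "z \<in> cball (v k) R" for z
        using vK[OF \<open>k \<le> N\<close>] \<open>K \<subseteq> U\<close> that by auto
      with *[OF that] M have "norm (x k) \<le> (2 * M + r) / R"
        by (intro approximate_subgradient_bound[OF \<open>0 < R\<close>, of "v k" p]) blast+
      also have "\<dots> \<le> L" using r(1) \<open>0 < R\<close> by (simp add: L_def divide_right_mono)
      finally show ?thesis .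
    qed
    have "(x 0 - x N) \<bullet> d - 2 * real N * (norm d + 2 * L + 3) * r \<le> (c N - c 0) - (p (v N) - p (v 0))"
    proof (rule chained_approximate_subgradients[where u = u and w = w and v = v and N = N and y = y
          and q = "\<lambda>k. p (v k)"])
      show "c k + u k \<bullet> (w (Suc k) - w k) - r \<le> c (Suc k)" if "Suc k \<le> N" for k
        using *[of k] *[of "Suc k"] that by (metis Suc_leD ereal_less_eq(3))
      show "p (v (Suc k)) + x (Suc k) \<bullet> (v k - v (Suc k)) - r \<le> p (v k)" if "Suc k \<le> N" for k
        using *[of "Suc k"] vU[of k] that by auto
    qed (use * r \<open>0 < r\<close> \<open>0 \<le> L\<close> xL in \<open>auto intro: less_imp_le\<close>)
    moreover have "- ((x 0 - x N) \<bullet> d) \<le> \<theta> / 4"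
    proof -
      have "- ((x 0 - x N) \<bullet> d) \<le> norm (x 0 - x N) * norm d"
        using Cauchy_Schwarz_ineq2[of "x 0 - x N" d] by linarith
      also have "\<dots> \<le> (2 * L) * norm d"
        using norm_triangle_ineq4[of "x 0" "x N"] xL[of 0] xL[of N] by (intro mult_right_mono) auto
      finally show ?thesis using d by simp
    qed
    moreover have "norm (v N - z) < ez" "norm (v 0 - y) < ey"
      using *[of N] *[of 0] r \<open>y + real N *\<^sub>R d = z\<close> by auto
    then have "p z - \<theta> / 8 \<le> p (v N)" "p (v 0) \<le> p y + \<theta> / 8"
      using ez(2)[of "v N"] ey(2)[of "v 0"] by argo+
    moreover have "- (u N \<bullet> (z - w N)) \<le> (L + 1) * r"
    proof -
      have "norm (u N) \<le> L + 1"
        using norm_triangle_ineq[of "x N" "u N - x N"] xL[of N] *[of N] r(1) by auto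
      moreover have "norm (z - w N) \<le> r"
        using *[of N] \<open>y + real N *\<^sub>R d = z\<close> by (simp add: norm_minus_commute)
      ultimately have "norm (u N) * norm (z - w N) \<le> (L + 1) * r"
        using \<open>0 \<le> L\<close> by (intro mult_mono) auto
      then show ?thesis using Cauchy_Schwarz_ineq2[of "u N" "z - w N"] by linarith
    qed
    ultimately have "c 0 - p y + p z - \<theta> \<le> c N + u N \<bullet> (z - w N) - r"
      using rA rL unfolding A_def by (simp add: algebra_simps)
    also have "ereal \<dots> \<le> f n z" using *[of N] by blast
    finally have "ereal (c 0 - p y + p z - \<theta>) \<le> f n z" by simp
    moreover have "norm (w 0 - y) < s" "f n (w 0) = ereal (c 0)" using *[of 0] r by auto
    ultimately show ?case by blast
  qed
qed

text \<open>
  The previous estimate is used with \<open>y\<close> replaced by each vertex of a small cross-polytope around \<open>y\<close>.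
  It provides a point \<open>w\<close> near each vertex, \<open>y\<close> lies in the convex hull of these points, and so convexity
  bounds \<open>f n y\<close> by the largest of their values. In particular \<open>f n y\<close> is finite.
\<close>

lemma difference_at_points:
  fixes f :: "nat \<Rightarrow> 'a::euclidean_space \<Rightarrow> ereal"
  assumes U: "open U" "convex U" and p: "continuous_on U p"
    and conv: "\<forall>\<^sub>F n in sequentially. convex_fun (f n)"
    and share: "\<And>y r. y \<in> U \<Longrightarrow> 0 < r \<Longrightarrow> \<forall>\<^sub>F n in sequentially. share_subgradient_near (f n) p U r y"
    and yz: "y \<in> U" "z \<in> U" and "0 < \<theta>"
  shows "\<forall>\<^sub>F n in sequentially. \<exists>c. f n y \<le> ereal c \<and> ereal (c - p y + p z - \<theta>) \<le> f n z"
proof -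
  have "isCont p y" using p U(1) yz(1) by (simp add: continuous_on_eq_continuous_at)
  then obtain e1 where e1: "0 < e1" "\<And>b. dist b y < e1 \<Longrightarrow> dist (p b) (p y) < \<theta> / 2"
    using \<open>0 < \<theta>\<close> unfolding continuous_at_eps_delta by (meson half_gt_zero)
  obtain e2 where e2: "0 < e2" "ball y e2 \<subseteq> U" using U(1) yz(1) open_contains_ball by blast
  define s where "s = min e1 e2 / 2"
  have s: "0 < s" "s < e1" "s < e2" using e1 e2 by (auto simp: s_def)
  define I :: "('a \<times> real) set" where "I = Basis \<times> {-1, 1}"
  have "finite I" "I \<noteq> {}" by (auto simp: I_def nonempty_Basis)
  define v where "v i = y + (snd i * s) *\<^sub>R fst i" for i :: "'a \<times> real"
  have vy: "dist (v i) y = s" if "i \<in> I" for i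
    using that s(1) by (auto simp: v_def I_def dist_norm)
  have v: "v i \<in> U \<and> p (v i) < p y + \<theta> / 2" if "i \<in> I" for i
  proof -
    have "dist (p (v i)) (p y) < \<theta> / 2" "v i \<in> ball y e2"
      using s e1(2)[of "v i"] vy[OF that] by (auto simp: dist_commute)
    then show ?thesis using e2(2) abs_ge_self[of "p (v i) - p y"]
      unfolding dist_real_def by (auto simp del: abs_ge_self)
  qed
  have "\<forall>\<^sub>F n in sequentially. \<forall>i\<in>I. \<exists>w c. norm (w - v i) < s / (2 * DIM('a)) \<and> f n w = ereal c \<and>
      ereal (c - p (v i) + p z - \<theta> / 2) \<le> f n z"
    using v \<open>0 < \<theta>\<close> s yz \<open>finite I\<close>
    by (intro eventually_ball_finite ballI difference_along_segment[OF U p share]) auto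
  with conv show ?thesis
  proof eventually_elim
    case (elim n)
    from elim(2) obtain w c where wc: "\<And>i. i \<in> I \<Longrightarrow> norm (w i - v i) < s / (2 * DIM('a)) \<and>
        f n (w i) = ereal (c i) \<and> ereal (c i - p (v i) + p z - \<theta> / 2) \<le> f n z"
      by metis
    define C where "C = Max (c ` I)"
    have "C \<in> c ` I" unfolding C_def using \<open>finite I\<close> \<open>I \<noteq> {}\<close> by (intro Max_in) auto
    then obtain i where i: "i \<in> I" "C = c i" by auto
    have "y \<in> convex hull {w (b, t) | b t. b \<in> Basis \<and> t \<in> {-1, 1}}"
    proof (rule mem_convex_hull_perturbed_cross[OF s(1)])
      show "norm (w (b, t) - (y + (t * s) *\<^sub>R b)) < s / (2 * DIM('a))"
        if "b \<in> Basis" "t \<in> {-1, 1}" for b t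
        using wc[of "(b, t)"] that unfolding I_def v_def by simp
    qed
    moreover have "{w (b, t) | b t. b \<in> Basis \<and> t \<in> {-1, 1}} \<subseteq> {x. f n x \<le> ereal C}"
      using wc \<open>finite I\<close> by (auto simp: C_def I_def intro!: Max_ge)
    ultimately have "f n y \<le> ereal C"
      using hull_minimal[of _ _ convex, OF _ convex_sublevel[OF elim(1)]] by blast
    moreover have "ereal (C - p y + p z - \<theta>) \<le> ereal (c i - p (v i) + p z - \<theta> / 2)"
      using v[OF i(1)] i(2) by simp
    then have "ereal (C - p y + p z - \<theta>) \<le> f n z" using wc[OF i(1)] order_trans by blast
    ultimately show ?case by blast
  qed
qed

text \<open>
  Exchanging the roles of the two points in the preceding estimate shows that \<open>f n x - p x\<close> and
  \<open>f n y - p y\<close> differ by an arbitrarily small amount for large \<open>n\<close>.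
\<close>

lemma convergence_from_shared_subgradients:
  fixes f :: "nat \<Rightarrow> 'a::euclidean_space \<Rightarrow> ereal"
  assumes U: "open U" "convex U" and p: "continuous_on U p"
    and conv: "\<forall>\<^sub>F n in sequentially. convex_fun (f n)"
    and share: "\<And>y r. y \<in> U \<Longrightarrow> 0 < r \<Longrightarrow> \<forall>\<^sub>F n in sequentially. share_subgradient_near (f n) p U r y"
  shows "\<exists>a :: nat \<Rightarrow> real. \<forall>x\<in>U. (\<lambda>n. f n x - ereal (a n)) \<longlonglongrightarrow> ereal (p x)"
proof (cases "U = {}")
  case False
  then obtain y where y: "y \<in> U" by auto
  define a where "a n = real_of_ereal (f n y) - p y" for n
  have "(\<lambda>n. f n x - ereal (a n)) \<longlonglongrightarrow> ereal (p x)" if x: "x \<in> U" for x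
  proof -
    have near: "\<forall>\<^sub>F n in sequentially. f n x = ereal (real_of_ereal (f n x)) \<and>
        \<bar>(real_of_ereal (f n x) - a n) - p x\<bar> \<le> \<theta>" if "0 < \<theta>" for \<theta>
    proof -
      have "\<forall>\<^sub>F n in sequentially. \<exists>c. f n x \<le> ereal c \<and> ereal (c - p x + p y - \<theta>) \<le> f n y"
        using U p conv share x y that by (rule difference_at_points)
      moreover
      have "\<forall>\<^sub>F n in sequentially. \<exists>c. f n y \<le> ereal c \<and> ereal (c - p y + p x - \<theta>) \<le> f n x"
        using U p conv share y x that by (rule difference_at_points)
      ultimately show ?thesis
      proof eventually_elim
        case (elim n)
        then obtain c1 c2 where "f n x \<le> ereal c1" "ereal (c1 - p x + p y - \<theta>) \<le> f n y"
            "f n y \<le> ereal c2" "ereal (c2 - p y + p x - \<theta>) \<le> f n x"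
          by blast
        then show ?case
          by (cases "f n x"; cases "f n y") (auto simp: a_def)
      qed
    qed
    have "(\<lambda>n. real_of_ereal (f n x) - a n) \<longlonglongrightarrow> p x"
    proof (rule tendstoI)
      fix e :: real assume "0 < e"
      then have "0 < e / 2" by simp
      from near[OF this] show "\<forall>\<^sub>F n in sequentially. dist (real_of_ereal (f n x) - a n) (p x) < e"
        by eventually_elim (use \<open>0 < e\<close> in \<open>auto simp: dist_real_def\<close>)
    qed
    then have "(\<lambda>n. ereal (real_of_ereal (f n x) - a n)) \<longlonglongrightarrow> ereal (p x)" by simp
    moreover have "\<forall>\<^sub>F n in sequentially. ereal (real_of_ereal (f n x) - a n) = f n x - ereal (a n)"
      using near[OF zero_less_one] by eventually_elim (metis ereal_minus(1))
    ultimately show ?thesis by (rule Lim_transform_eventually)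
  qed
  then show ?thesis by blast
qed auto

section \<open>Integrable extended-valued functions and dual pairs\<close>

lemma borel_prob_measurable [simp]:
  "borel_prob M \<Longrightarrow> f \<in> borel_measurable M \<longleftrightarrow> f \<in> borel_measurable borel"
  unfolding borel_prob_def by (auto intro!: arg_cong[of _ _ "\<lambda>A. f \<in> A"] measurable_cong_sets)

lemma L1_iff:
  "f \<in> L1 M \<longleftrightarrow> f \<in> borel_measurable M \<and> integrable M (\<lambda>x. real_of_ereal (f x)) \<and>
     (AE x in M. \<bar>f x\<bar> \<noteq> \<infinity>)"
proof safe
  assume f: "f \<in> L1 M"
  then show [measurable]: "f \<in> borel_measurable M" by (simp add: L1_def)
  have fin: "(\<integral>\<^sup>+ x. e2ennreal \<bar>f x\<bar> \<partial>M) < \<infinity>" using f by (simp add: L1_def)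
  then have "AE x in M. e2ennreal \<bar>f x\<bar> \<noteq> \<infinity>"
    by (intro nn_integral_noteq_infinite) auto
  then show "AE x in M. \<bar>f x\<bar> \<noteq> \<infinity>" by eventually_elim auto
  show "integrable M (\<lambda>x. real_of_ereal (f x))"
  proof (rule integrableI_bounded)
    have "ennreal (norm (real_of_ereal (f x))) \<le> e2ennreal \<bar>f x\<bar>" for x
      by (cases "f x") auto
    then have "(\<integral>\<^sup>+ x. ennreal (norm (real_of_ereal (f x))) \<partial>M) \<le> (\<integral>\<^sup>+ x. e2ennreal \<bar>f x\<bar> \<partial>M)"
      by (intro nn_integral_mono)
    then show "(\<integral>\<^sup>+ x. ennreal (norm (real_of_ereal (f x))) \<partial>M) < \<infinity>"
      using fin by (rule le_less_trans)
  qed measurable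
next
  assume f: "f \<in> borel_measurable M" "integrable M (\<lambda>x. real_of_ereal (f x))"
    and fin: "AE x in M. \<bar>f x\<bar> \<noteq> \<infinity>"
  have "(\<integral>\<^sup>+ x. e2ennreal \<bar>f x\<bar> \<partial>M) = (\<integral>\<^sup>+ x. ennreal (norm (real_of_ereal (f x))) \<partial>M)"
    by (rule nn_integral_cong_AE, use fin in eventually_elim)
      (metis abs_ereal.simps(1) e2ennreal_ereal ereal_real' real_norm_def)
  also have "\<dots> < \<infinity>" using f(2) unfolding integrable_iff_bounded by blast
  finally show "f \<in> L1 M" using f(1) by (simp add: L1_def)
qed

lemma L1_I:
  assumes f: "f \<in> borel_measurable M" and k: "integrable M k" and eq: "AE x in M. f x = ereal (k x)"
  shows "f \<in> L1 M" and "L1_integral M f = (\<integral>x. k x \<partial>M)"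
proof -
  have ae: "AE x in M. real_of_ereal (f x) = k x" using eq by eventually_elim simp
  have [measurable]: "f \<in> borel_measurable M" "k \<in> borel_measurable M" using f k by auto
  have "integrable M (\<lambda>x. real_of_ereal (f x))"
    using k ae by (subst integrable_cong_AE) auto
  moreover have "AE x in M. \<bar>f x\<bar> \<noteq> \<infinity>" using eq by eventually_elim simp
  ultimately show "f \<in> L1 M" using f by (simp add: L1_iff)
  show "L1_integral M f = (\<integral>x. k x \<partial>M)"
    unfolding L1_integral_def using ae by (intro integral_cong_AE) auto
qed

lemma L1_finite_point:
  assumes "prob_space M" "f \<in> L1 M"
  obtains x where "\<bar>f x\<bar> \<noteq> \<infinity>"
proof -
  interpret prob_space M by fact
  have "AE x in M. \<bar>f x\<bar> \<noteq> \<infinity>" using assms(2) by (simp add: L1_iff)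
  from eventually_happens'[OF ae_filter_bot this] obtain x where "\<bar>f x\<bar> \<noteq> \<infinity>" ..
  then show thesis by (rule that)
qed

text \<open>
  The value \<open>-\<infinity>\<close> at one point would force the other function to be \<open>\<infinity>\<close> everywhere, which integrability
  excludes.
\<close>

lemma dual_pairs_not_MInf:
  assumes "prob_space P" "prob_space Q" "(f, g) \<in> dual_pairs P Q"
  shows "f x \<noteq> -\<infinity>" "g y \<noteq> -\<infinity>"
proof -
  have ge: "ereal (x \<bullet> y) \<le> f x + g y" for x y using assms(3) by (auto simp: dual_pairs_def)
  obtain x0 where "\<bar>f x0\<bar> \<noteq> \<infinity>" using L1_finite_point[OF assms(1), of f] assms(3)
    by (auto simp: dual_pairs_def)
  with ge[of x0 y] show "g y \<noteq> -\<infinity>" by (cases "f x0") auto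
  obtain y0 where "\<bar>g y0\<bar> \<noteq> \<infinity>" using L1_finite_point[OF assms(2), of g] assms(3)
    by (auto simp: dual_pairs_def)
  with ge[of x y0] show "f x \<noteq> -\<infinity>" by (cases "g y0") auto
qed

text \<open>
  A finite value bounds the quadratic envelope of \<open>f\<close> from above, an affine minorant from below, both
  with at most quadratic growth.
\<close>

lemma dual_pairs_finite_affine:
  assumes "prob_space P" "prob_space Q" "(f, g) \<in> dual_pairs P Q"
  obtains y0 b0 u0 c0 where "\<And>u. ereal (u \<bullet> y0 - b0) \<le> f u" "f u0 = ereal c0"
proof -
  have ge: "ereal (x \<bullet> y) \<le> f x + g y" for x y using assms(3) by (auto simp: dual_pairs_def)
  obtain u0 where "\<bar>f u0\<bar> \<noteq> \<infinity>" using L1_finite_point[OF assms(1), of f] assms(3)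
    by (auto simp: dual_pairs_def)
  then obtain c0 where c0: "f u0 = ereal c0" by auto
  obtain y0 where "\<bar>g y0\<bar> \<noteq> \<infinity>" using L1_finite_point[OF assms(2), of g] assms(3)
    by (auto simp: dual_pairs_def)
  then obtain b0 where "g y0 = ereal b0" by auto
  then have "ereal (u \<bullet> y0 - b0) \<le> f u" for u
    using ge[of u y0] by (cases "f u") auto
  with c0 that show thesis by blast
qed

lemma dual_pairs_swap: "(f, g) \<in> dual_pairs P Q \<Longrightarrow> (g, f) \<in> dual_pairs Q P"
  unfolding dual_pairs_def by (auto, metis add.commute inner_commute)

lemma L1_mean:
  assumes f: "f \<in> L1 M" and g: "g \<in> L1 M"
  shows "(\<lambda>x. ereal (1 / 2) * (f x + g x)) \<in> L1 M"
    and "L1_integral M (\<lambda>x. ereal (1 / 2) * (f x + g x)) = (L1_integral M f + L1_integral M g) / 2"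
proof -
  note fg = f[unfolded L1_iff] g[unfolded L1_iff]
  have meas: "(\<lambda>x. ereal (1 / 2) * (f x + g x)) \<in> borel_measurable M"
    using fg by (intro borel_measurable_ereal_times borel_measurable_ereal_add) auto
  have int: "integrable M (\<lambda>x. (real_of_ereal (f x) + real_of_ereal (g x)) / 2)"
    using fg by auto
  have "AE x in M. \<bar>f x\<bar> \<noteq> \<infinity>" "AE x in M. \<bar>g x\<bar> \<noteq> \<infinity>" using fg by auto
  then have ae: "AE x in M. ereal (1 / 2) * (f x + g x) =
      ereal ((real_of_ereal (f x) + real_of_ereal (g x)) / 2)"
  proof eventually_elim
    case (elim x)
    then show ?case by (cases "f x"; cases "g x") auto
  qed
  show "(\<lambda>x. ereal (1 / 2) * (f x + g x)) \<in> L1 M" by (rule L1_I(1)[OF meas int ae])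
  have "L1_integral M (\<lambda>x. ereal (1 / 2) * (f x + g x)) =
      (\<integral>x. (real_of_ereal (f x) + real_of_ereal (g x)) / 2 \<partial>M)"
    by (rule L1_I(2)[OF meas int ae])
  also have "\<dots> = (L1_integral M f + L1_integral M g) / 2"
    unfolding L1_integral_def using fg by simp
  finally show "L1_integral M (\<lambda>x. ereal (1 / 2) * (f x + g x)) =
      (L1_integral M f + L1_integral M g) / 2" .
qed

section \<open>Couplings of small cost\<close>

text \<open>
  One coupling of small cost is what a small Wasserstein distance provides. The integrability clause
  gives the bound its meaning, since the Bochner integral of a function that is not integrable is 0.
\<close>

definition coupled_within :: "real \<Rightarrow> 'a::euclidean_space measure \<Rightarrow> 'a measure \<Rightarrow> bool" where
  "coupled_within c P Q \<longleftrightarrow> (\<exists>\<pi>\<in>couplings P Q.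
     integrable \<pi> (\<lambda>z. (norm (fst z - snd z))\<^sup>2) \<and> (\<integral>z. (norm (fst z - snd z))\<^sup>2 \<partial>\<pi>) \<le> c)"

lemma couplings_marginals:
  fixes P Q :: "'a::euclidean_space measure"
  assumes "\<pi> \<in> couplings P Q"
  shows "sets \<pi> = sets borel" "fst \<in> measurable \<pi> borel" "snd \<in> measurable \<pi> borel"
    "P = distr \<pi> borel fst" "Q = distr \<pi> borel snd"
proof -
  show s: "sets \<pi> = sets borel" and "P = distr \<pi> borel fst" "Q = distr \<pi> borel snd"
    using assms by (auto simp: couplings_def borel_prob_def)
  show "fst \<in> measurable \<pi> borel" "snd \<in> measurable \<pi> borel"
    unfolding measurable_cong_sets[OF s refl]
    by (simp_all add: borel_measurable_continuous_onI continuous_intros)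
qed

lemma coupled_within_sym:
  fixes P Q :: "'a::euclidean_space measure"
  assumes "coupled_within c P Q"
  shows "coupled_within c Q P"
proof -
  obtain \<pi> where \<pi>: "\<pi> \<in> couplings P Q" "integrable \<pi> (\<lambda>z. (norm (fst z - snd z))\<^sup>2)"
      "(\<integral>z. (norm (fst z - snd z))\<^sup>2 \<partial>\<pi>) \<le> c"
    using assms by (auto simp: coupled_within_def)
  note m = couplings_marginals[OF \<pi>(1)]
  define s :: "'a \<times> 'a \<Rightarrow> 'a \<times> 'a" where "s z = (snd z, fst z)" for z
  have [measurable]: "s \<in> borel \<rightarrow>\<^sub>M borel" "s \<in> \<pi> \<rightarrow>\<^sub>M borel"
    unfolding measurable_cong_sets[OF m(1) refl]
    by (auto simp: s_def intro!: borel_measurable_continuous_onI continuous_intros)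
  have [measurable]: "(fst :: 'a \<times> 'a \<Rightarrow> 'a) \<in> borel \<rightarrow>\<^sub>M borel" "(snd :: 'a \<times> 'a \<Rightarrow> 'a) \<in> borel \<rightarrow>\<^sub>M borel"
    by (auto intro!: borel_measurable_continuous_onI continuous_intros)
  have cost: "(\<lambda>z::'a \<times> 'a. (norm (fst z - snd z))\<^sup>2) \<in> borel_measurable borel"
    by (intro borel_measurable_continuous_onI continuous_intros)
  have "prob_space \<pi>" using \<pi>(1) by (simp add: couplings_def borel_prob_def)
  then have "prob_space (distr \<pi> borel s)" by (intro prob_space.prob_space_distr) measurable
  moreover have "fst \<circ> s = snd" "snd \<circ> s = fst" by (auto simp: s_def)
  ultimately have "distr \<pi> borel s \<in> couplings Q P"
    using m(4,5) by (simp add: couplings_def borel_prob_def distr_distr)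
  moreover have "(\<lambda>z. (norm (fst (s z) - snd (s z)))\<^sup>2) = (\<lambda>z. (norm (fst z - snd z))\<^sup>2)"
    by (simp add: s_def norm_minus_commute)
  then have "integrable (distr \<pi> borel s) (\<lambda>z. (norm (fst z - snd z))\<^sup>2)"
    "(\<integral>z. (norm (fst z - snd z))\<^sup>2 \<partial>distr \<pi> borel s) \<le> c"
    using \<pi>(2,3) cost by (simp_all add: integrable_distr_eq integral_distr)
  ultimately show ?thesis unfolding coupled_within_def by blast
qed

lemma norm_diff_square_le: "(norm (a - b))\<^sup>2 \<le> 2 * (norm a)\<^sup>2 + 2 * (norm b)\<^sup>2"
  for a b :: "'a::real_normed_vector"
proof -
  have "(norm (a - b))\<^sup>2 \<le> (norm a + norm b)\<^sup>2"
    by (intro power_mono norm_triangle_ineq4) auto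
  also have "\<dots> \<le> 2 * (norm a)\<^sup>2 + 2 * (norm b)\<^sup>2"
    using sum_squares_bound[of "norm a" "norm b"] by (simp add: power2_sum)
  finally show ?thesis .
qed

text \<open>
  The product measure is a coupling of finite cost. This matters because \<open>wasserstein2\<close> turns an
  infinite cost into the distance 0.
\<close>

lemma wasserstein2_sq_finite:
  fixes P Q :: "'a::euclidean_space measure"
  assumes P: "borel_prob P" "finite_second_moment P" and Q: "borel_prob Q" "finite_second_moment Q"
  shows "wasserstein2_sq P Q < \<infinity>"
proof -
  interpret P: prob_space P using P by (simp add: borel_prob_def)
  interpret Q: prob_space Q using Q by (simp add: borel_prob_def)
  interpret PQ: pair_prob_space P Q ..
  have sP: "sets P = sets borel" and sQ: "sets Q = sets borel"
    using P Q by (auto simp: borel_prob_def)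
  let ?\<pi> = "P \<Otimes>\<^sub>M Q"
  have s: "sets ?\<pi> = sets borel"
    using sets_pair_measure_cong[OF sP sQ] unfolding borel_prod .
  have "distr ?\<pi> borel fst = distr ?\<pi> P fst" by (rule distr_cong) (simp_all add: sP)
  also have "\<dots> = P" by (rule Q.distr_pair_fst)
  finally have d1: "distr ?\<pi> borel fst = P" .
  have "distr ?\<pi> borel snd = distr (distr (Q \<Otimes>\<^sub>M P) ?\<pi> (\<lambda>(x, y). (y, x))) Q snd"
    by (subst PQ.distr_pair_swap) (rule distr_cong; simp add: sQ)
  also have "\<dots> = distr (Q \<Otimes>\<^sub>M P) Q fst"
    by (subst distr_distr) (auto intro!: distr_cong)
  also have "\<dots> = Q" by (rule P.distr_pair_fst)
  finally have d2: "distr ?\<pi> borel snd = Q" .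
  have "?\<pi> \<in> couplings P Q"
    using s d1 d2 PQ.prob_space_axioms by (simp add: couplings_def borel_prob_def)
  then have "wasserstein2_sq P Q \<le> (\<integral>\<^sup>+ (x, y). ennreal ((norm (x - y))\<^sup>2) \<partial>?\<pi>)"
    unfolding wasserstein2_sq_def by (rule INF_lower)
  also have "\<dots> \<le> (\<integral>\<^sup>+ z. ennreal (2 * (norm (fst z))\<^sup>2) + ennreal (2 * (norm (snd z))\<^sup>2) \<partial>?\<pi>)"
    by (intro nn_integral_mono) (auto simp: norm_diff_square_le simp flip: ennreal_plus intro!: ennreal_leI)
  also have "\<dots> = (\<integral>\<^sup>+ z. ennreal (2 * (norm (fst z))\<^sup>2) \<partial>?\<pi>) + (\<integral>\<^sup>+ z. ennreal (2 * (norm (snd z))\<^sup>2) \<partial>?\<pi>)"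
    unfolding nn_integral_cong[of ?\<pi>]
    by (rule nn_integral_add)
      (auto simp: measurable_cong_sets[OF s refl]
        intro!: measurable_compose[OF _ measurable_ennreal] borel_measurable_continuous_onI continuous_intros)
  also have "(\<integral>\<^sup>+ z. ennreal (2 * (norm (fst z))\<^sup>2) \<partial>?\<pi>) = (\<integral>\<^sup>+ x. ennreal (2 * (norm x)\<^sup>2) \<partial>P)"
    by (subst (2) d1[symmetric], subst nn_integral_distr) (auto simp: sP cong: measurable_cong_sets)
  also have "(\<integral>\<^sup>+ z. ennreal (2 * (norm (snd z))\<^sup>2) \<partial>?\<pi>) = (\<integral>\<^sup>+ x. ennreal (2 * (norm x)\<^sup>2) \<partial>Q)"
    by (subst (2) d2[symmetric], subst nn_integral_distr) (auto simp: sQ cong: measurable_cong_sets)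
  also have "(\<integral>\<^sup>+ x. ennreal (2 * (norm x)\<^sup>2) \<partial>P) + (\<integral>\<^sup>+ x. ennreal (2 * (norm x)\<^sup>2) \<partial>Q) < \<infinity>"
  proof -
    have "integrable P (\<lambda>x. 2 * (norm x)\<^sup>2)" "integrable Q (\<lambda>x. 2 * (norm x)\<^sup>2)"
      using P Q by (simp_all add: finite_second_moment_def)
    then show ?thesis by (simp add: nn_integral_eq_integral)
  qed
  finally show ?thesis .
qed

lemma coupled_within_if_wasserstein2_less:
  fixes P Q :: "'a::euclidean_space measure"
  assumes PQ: "borel_prob P" "finite_second_moment P" "borel_prob Q" "finite_second_moment Q"
    and c: "wasserstein2 P Q < sqrt c"
  shows "coupled_within c P Q"
proof -
  have "enn2real (wasserstein2_sq P Q) < c" using c by (simp add: wasserstein2_def)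
  then have "wasserstein2_sq P Q < ennreal c"
    using wasserstein2_sq_finite[OF PQ] by (cases "wasserstein2_sq P Q") (auto simp: ennreal_less_iff)
  then obtain \<pi> where \<pi>: "\<pi> \<in> couplings P Q"
      and less: "(\<integral>\<^sup>+ (x, y). ennreal ((norm (x - y))\<^sup>2) \<partial>\<pi>) < ennreal c"
    unfolding wasserstein2_sq_def INF_less_iff by auto
  have nn: "(\<integral>\<^sup>+ z. ennreal ((norm (fst z - snd z))\<^sup>2) \<partial>\<pi>) < ennreal c"
    using less by (simp add: case_prod_beta')
  note [measurable] = couplings_marginals(2,3)[OF \<pi>]
  have int: "integrable \<pi> (\<lambda>z. (norm (fst z - snd z))\<^sup>2)"
    using nn by (intro integrableI_bounded) (auto simp: less_top[symmetric])
  have "0 < c" using nn by (metis ennreal_neg linorder_not_le not_less_zero)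
  have "ennreal (\<integral>z. (norm (fst z - snd z))\<^sup>2 \<partial>\<pi>) < ennreal c"
    using nn by (simp add: nn_integral_eq_integral[OF int])
  then have "(\<integral>z. (norm (fst z - snd z))\<^sup>2 \<partial>\<pi>) \<le> c"
    using \<open>0 < c\<close> by (simp add: ennreal_less_iff)
  with \<pi> int show ?thesis unfolding coupled_within_def by blast
qed

lemma second_moment_coupled_le:
  fixes P Q :: "'a::euclidean_space measure"
  assumes "finite_second_moment P" "finite_second_moment Q" "coupled_within c P Q"
  shows "(\<integral>x. (norm x)\<^sup>2 \<partial>P) \<le> 2 * (\<integral>x. (norm x)\<^sup>2 \<partial>Q) + 2 * c"
proof -
  obtain \<pi> where \<pi>: "\<pi> \<in> couplings P Q" and int: "integrable \<pi> (\<lambda>z. (norm (fst z - snd z))\<^sup>2)"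
      and c: "(\<integral>z. (norm (fst z - snd z))\<^sup>2 \<partial>\<pi>) \<le> c"
    using assms(3) by (auto simp: coupled_within_def)
  note m = couplings_marginals[OF \<pi>]
  have i1: "integrable \<pi> (\<lambda>z. (norm (fst z))\<^sup>2)" and e1: "(\<integral>x. (norm x)\<^sup>2 \<partial>P) = (\<integral>z. (norm (fst z))\<^sup>2 \<partial>\<pi>)"
    using assms(1) m(2) by (auto simp: finite_second_moment_def m(4) integrable_distr_eq integral_distr)
  have i2: "integrable \<pi> (\<lambda>z. (norm (snd z))\<^sup>2)" and e2: "(\<integral>x. (norm x)\<^sup>2 \<partial>Q) = (\<integral>z. (norm (snd z))\<^sup>2 \<partial>\<pi>)"
    using assms(2) m(3) by (auto simp: finite_second_moment_def m(5) integrable_distr_eq integral_distr)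
  have "(\<integral>z. (norm (fst z))\<^sup>2 \<partial>\<pi>) \<le> (\<integral>z. 2 * (norm (fst z - snd z))\<^sup>2 + 2 * (norm (snd z))\<^sup>2 \<partial>\<pi>)"
    using i1 i2 int norm_diff_square_le[of "fst z - snd z" "- snd z" for z]
    by (intro integral_mono) auto
  also have "\<dots> = 2 * (\<integral>z. (norm (fst z - snd z))\<^sup>2 \<partial>\<pi>) + 2 * (\<integral>z. (norm (snd z))\<^sup>2 \<partial>\<pi>)"
    using i2 int by simp
  finally show ?thesis using c e1 e2 by linarith
qed

section \<open>Transporting a dual pair to nearby measures\<close>

text \<open>
  The infimum alone is a Moreau envelope. The added \<open>e * (norm x)\<^sup>2\<close> compensates for what the
  envelopes lose in the constraint \<open>f x + g y \<ge> x \<bullet> y\<close>, see \<open>inner_perturbation\<close>.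
\<close>

definition quad_env :: "real \<Rightarrow> ('a::euclidean_space \<Rightarrow> ereal) \<Rightarrow> 'a \<Rightarrow> ereal" where
  "quad_env e f x = (INF u. f u + ereal ((norm (u - x))\<^sup>2 / e + e * (norm x)\<^sup>2))"

text \<open>
  For each \<open>u\<close> the expression under the infimum is continuous in \<open>x\<close>, so the envelope is upper
  semicontinuous.
\<close>

lemma quad_env_measurable: "quad_env e f \<in> borel_measurable borel"
proof (rule borel_measurableI_less)
  fix a
  have "open {x. f u + ereal ((norm (u - x))\<^sup>2 / e + e * (norm x)\<^sup>2) < a}" for u
  proof (cases "f u")
    case (real r)
    then show ?thesis
      by (intro open_Collect_less) (auto simp: divide_inverse intro!: continuous_intros)
  qed (cases "-\<infinity> < a"; auto)+
  then have "open (\<Union>u. {x. f u + ereal ((norm (u - x))\<^sup>2 / e + e * (norm x)\<^sup>2) < a})"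
    by blast
  moreover have "{x \<in> space borel. quad_env e f x < a} =
      (\<Union>u. {x. f u + ereal ((norm (u - x))\<^sup>2 / e + e * (norm x)\<^sup>2) < a})"
    by (auto simp: quad_env_def INF_less_iff)
  ultimately show "{x \<in> space borel. quad_env e f x < a} \<in> sets borel" by simp
qed

text \<open>
  Expand \<open>u \<bullet> w\<close> around \<open>x \<bullet> y\<close> and absorb the three cross terms by Young's inequality; half of the
  quadratic penalty, together with the terms in \<open>x\<close> and \<open>y\<close>, is enough for this. The other half, kept on the left, is what later forces \<open>u\<close> and
  \<open>w\<close> to be close to \<open>x\<close> and \<open>y\<close>.
\<close>

lemma inner_perturbation:
  fixes x y u w :: "'a::real_inner"
  assumes "0 < e" "e \<le> 1 / 2"
  shows "x \<bullet> y + ((norm (u - x))\<^sup>2 + (norm (w - y))\<^sup>2) / (2 * e) \<le>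
    u \<bullet> w + ((norm (u - x))\<^sup>2 / e + e * (norm x)\<^sup>2) + ((norm (w - y))\<^sup>2 / e + e * (norm y)\<^sup>2)"
proof -
  define a b where "a = u - x" and "b = w - y"
  have young: "s * t \<le> e * s\<^sup>2 + t\<^sup>2 / (4 * e)" for s t :: real
  proof -
    have "0 \<le> (2 * e * s - t)\<^sup>2 / (4 * e)" using \<open>0 < e\<close> by simp
    also have "\<dots> = e * s\<^sup>2 + t\<^sup>2 / (4 * e) - s * t"
      using \<open>0 < e\<close> by (simp add: field_simps power2_eq_square)
    finally show ?thesis by simp
  qed
  have "- (norm x * norm b) \<le> x \<bullet> b" "- (norm y * norm a) \<le> a \<bullet> y" "- (norm a * norm b) \<le> a \<bullet> b"
    using Cauchy_Schwarz_ineq2[of x b] Cauchy_Schwarz_ineq2[of y a] Cauchy_Schwarz_ineq2[of a b]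
    by (auto simp: inner_commute[of a y])
  moreover have "norm a * norm b \<le> ((norm a)\<^sup>2 + (norm b)\<^sup>2) / (4 * e)"
  proof -
    have "norm a * norm b \<le> ((norm a)\<^sup>2 + (norm b)\<^sup>2) / 2"
      using sum_squares_bound[of "norm a" "norm b"] by simp
    also have "\<dots> \<le> ((norm a)\<^sup>2 + (norm b)\<^sup>2) / (4 * e)"
      using assms by (intro divide_left_mono) auto
    finally show ?thesis .
  qed
  moreover note young[of "norm x" "norm b"] young[of "norm y" "norm a"]
  ultimately have bounds: "- (e * (norm x)\<^sup>2 + (norm b)\<^sup>2 / (4 * e)) \<le> x \<bullet> b"
      "- (e * (norm y)\<^sup>2 + (norm a)\<^sup>2 / (4 * e)) \<le> a \<bullet> y"
      "- ((norm a)\<^sup>2 / (4 * e) + (norm b)\<^sup>2 / (4 * e)) \<le> a \<bullet> b"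
    by (simp_all add: add_divide_distrib)
  have expand: "u \<bullet> w = x \<bullet> y + x \<bullet> b + a \<bullet> y + a \<bullet> b"
    by (simp add: a_def b_def algebra_simps)
  have halves: "s / e = 4 * (s / (4 * e))" "s / (2 * e) = 2 * (s / (4 * e))" for s :: real
    using \<open>0 < e\<close> by (simp_all add: field_simps)
  define A B X Y where "A = (norm a)\<^sup>2 / (4 * e)" and "B = (norm b)\<^sup>2 / (4 * e)"
    and "X = e * (norm x)\<^sup>2" and "Y = e * (norm y)\<^sup>2"
  show ?thesis
    using bounds
    unfolding a_def[symmetric] b_def[symmetric] halves add_divide_distrib expand
      A_def[symmetric] B_def[symmetric] X_def[symmetric] Y_def[symmetric]
    by argo
qed

lemma abs_inner_le_half_squares: "\<bar>a \<bullet> b\<bar> \<le> ((norm a)\<^sup>2 + (norm b)\<^sup>2) / 2"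
  using Cauchy_Schwarz_ineq2[of a b] sum_squares_bound[of "norm a" "norm b"] by simp

lemma quad_env_bound:
  fixes f :: "'a::euclidean_space \<Rightarrow> ereal"
  assumes e: "0 < e" "e \<le> 1" and affine: "\<And>u. ereal (u \<bullet> y0 - b0) \<le> f u" and u0: "f u0 = ereal c0"
  obtains A where "\<And>x. \<exists>r. quad_env e f x = ereal r \<and> \<bar>r\<bar> \<le> A * (1 + (norm x)\<^sup>2)"
proof
  define l where "l = 1 + (norm y0)\<^sup>2 + \<bar>b0\<bar>"
  define A where "A = \<bar>c0\<bar> + 2 * (norm u0)\<^sup>2 / e + 2 / e + e + l"
  fix x :: 'a
  have up: "quad_env e f x \<le> ereal (A * (1 + (norm x)\<^sup>2))"
  proof -
    have "(norm (u0 - x))\<^sup>2 / e \<le> (2 * (norm u0)\<^sup>2 + 2 * (norm x)\<^sup>2) / e"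
      using e by (intro divide_right_mono norm_diff_square_le) auto
    then have "c0 + ((norm (u0 - x))\<^sup>2 / e + e * (norm x)\<^sup>2) \<le>
        (\<bar>c0\<bar> + 2 * (norm u0)\<^sup>2 / e) * 1 + (2 / e + e) * (norm x)\<^sup>2"
      by (simp add: algebra_simps add_divide_distrib)
    also have "\<dots> \<le> A * 1 + A * (norm x)\<^sup>2"
      using e by (intro add_mono mult_right_mono) (auto simp: A_def l_def add_nonneg_nonneg)
    finally have "c0 + ((norm (u0 - x))\<^sup>2 / e + e * (norm x)\<^sup>2) \<le> A * (1 + (norm x)\<^sup>2)"
      by (simp add: algebra_simps)
    moreover have "quad_env e f x \<le> f u0 + ereal ((norm (u0 - x))\<^sup>2 / e + e * (norm x)\<^sup>2)"
      unfolding quad_env_def by (rule INF_lower) simp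
    ultimately show ?thesis using u0 by (simp add: order_trans)
  qed
  have low: "ereal (- (A * (1 + (norm x)\<^sup>2))) \<le> quad_env e f x"
    unfolding quad_env_def
  proof (rule INF_greatest)
    fix u
    have "- (l * (1 + (norm x)\<^sup>2)) \<le> u \<bullet> y0 - b0 + ((norm (u - x))\<^sup>2 / e + e * (norm x)\<^sup>2)"
    proof -
      have "- ((norm x)\<^sup>2 + (norm y0)\<^sup>2) / 2 \<le> x \<bullet> y0"
        using abs_inner_le_half_squares[of x y0] by linarith
      moreover have "- ((norm (u - x))\<^sup>2 + (norm y0)\<^sup>2) / 2 \<le> (u - x) \<bullet> y0"
        using abs_inner_le_half_squares[of "u - x" y0] by linarith
      moreover have "(norm (u - x))\<^sup>2 \<le> (norm (u - x))\<^sup>2 / e"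
        using e by (simp add: pos_le_divide_eq mult_left_le)
      moreover have "u \<bullet> y0 = x \<bullet> y0 + (u - x) \<bullet> y0" by (simp add: algebra_simps)
      moreover have "0 \<le> e * (norm x)\<^sup>2" using e by simp
      moreover have "(norm x)\<^sup>2 + (norm y0)\<^sup>2 + b0 \<le> l * (1 + (norm x)\<^sup>2)"
      proof -
        have "(norm x)\<^sup>2 \<le> l * (norm x)\<^sup>2"
          using mult_right_mono[of 1 l "(norm x)\<^sup>2"] by (simp add: l_def)
        moreover have "(norm y0)\<^sup>2 + b0 \<le> l" by (simp add: l_def)
        moreover have "l * (1 + (norm x)\<^sup>2) = l + l * (norm x)\<^sup>2" by (simp add: distrib_left)
        ultimately show ?thesis by linarith
      qed
      moreover have "0 \<le> (norm x)\<^sup>2" "0 \<le> (norm (u - x))\<^sup>2" by auto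
      ultimately show ?thesis by argo
    qed
    moreover have "l * (1 + (norm x)\<^sup>2) \<le> A * (1 + (norm x)\<^sup>2)"
      using e by (intro mult_right_mono) (auto simp: A_def)
    ultimately have "ereal (- (A * (1 + (norm x)\<^sup>2))) \<le>
        ereal (u \<bullet> y0 - b0) + ereal ((norm (u - x))\<^sup>2 / e + e * (norm x)\<^sup>2)"
      by simp
    also have "\<dots> \<le> f u + ereal ((norm (u - x))\<^sup>2 / e + e * (norm x)\<^sup>2)"
      using affine by (intro add_right_mono)
    finally show "ereal (- (A * (1 + (norm x)\<^sup>2))) \<le>
        f u + ereal ((norm (u - x))\<^sup>2 / e + e * (norm x)\<^sup>2)" .
  qed
  show "\<exists>r. quad_env e f x = ereal r \<and> \<bar>r\<bar> \<le> A * (1 + (norm x)\<^sup>2)"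
    using up low by (cases "quad_env e f x") (auto simp: abs_le_iff)
qed

lemma integrable_quadratic_growth:
  fixes P :: "'a::euclidean_space measure"
  assumes P: "borel_prob P" "finite_second_moment P"
    and k: "k \<in> borel_measurable borel" "\<And>x. \<bar>k x\<bar> \<le> A * (1 + (norm x)\<^sup>2)"
  shows "integrable P k"
proof (rule Bochner_Integration.integrable_bound)
  interpret prob_space P using P by (simp add: borel_prob_def)
  show "integrable P (\<lambda>x. A * (1 + (norm x)\<^sup>2))"
    using P(2) by (simp add: finite_second_moment_def)
  have "0 \<le> A" using k(2)[of 0] by simp
  then show "AE x in P. norm (k x) \<le> norm (A * (1 + (norm x)\<^sup>2))"
    using k(2) by (simp add: abs_mult)
qed (use P k in simp)

lemma quad_env_L1:
  fixes P' :: "'a::euclidean_space measure"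
  assumes "prob_space P" "prob_space Q" "(f, g) \<in> dual_pairs P Q"
    and P': "borel_prob P'" "finite_second_moment P'" and e: "0 < e" "e \<le> 1"
  shows "\<bar>quad_env e f x\<bar> \<noteq> \<infinity>" and "integrable P' (\<lambda>x. real_of_ereal (quad_env e f x))"
    and "quad_env e f \<in> L1 P'"
proof -
  obtain y0 b0 u0 c0 where "\<And>u. ereal (u \<bullet> y0 - b0) \<le> f u" "f u0 = ereal c0"
    using dual_pairs_finite_affine[OF assms(1-3)] by blast
  from quad_env_bound[OF e this]
  obtain A where A: "\<And>x. \<exists>r. quad_env e f x = ereal r \<and> \<bar>r\<bar> \<le> A * (1 + (norm x)\<^sup>2)" by blast
  then have fin: "\<bar>quad_env e f x\<bar> \<noteq> \<infinity>" for x by (metis PInfty_neq_ereal(1) abs_ereal.simps(1))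
  then show "\<bar>quad_env e f x\<bar> \<noteq> \<infinity>" .
  show int: "integrable P' (\<lambda>x. real_of_ereal (quad_env e f x))"
  proof (rule integrable_quadratic_growth[OF P'])
    show "\<bar>real_of_ereal (quad_env e f x)\<bar> \<le> A * (1 + (norm x)\<^sup>2)" for x
      using A[of x] by auto
  qed (use quad_env_measurable in measurable)
  show "quad_env e f \<in> L1 P'"
    using int fin P'(1) quad_env_measurable by (simp add: L1_iff)
qed

text \<open>
  For a pair \<open>(x, x')\<close> drawn from a coupling, the envelope at \<open>x'\<close> is at most the expression under the
  infimum taken at \<open>u = x\<close>; integrating this bound over the coupling gives the claim.
\<close>

lemma quad_env_integral_le:
  fixes P P' :: "'a::euclidean_space measure"
  assumes P: "borel_prob P" and P': "finite_second_moment P'" and c: "coupled_within c P P'"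
    and f: "f \<in> L1 P" and "0 < e"
    and F: "\<And>x. \<bar>quad_env e f x\<bar> \<noteq> \<infinity>" "integrable P' (\<lambda>x. real_of_ereal (quad_env e f x))"
  shows "L1_integral P' (quad_env e f) \<le> L1_integral P f + c / e + e * (\<integral>x. (norm x)\<^sup>2 \<partial>P')"
proof -
  obtain \<pi> where \<pi>: "\<pi> \<in> couplings P P'" and int: "integrable \<pi> (\<lambda>z. (norm (fst z - snd z))\<^sup>2)"
      and c: "(\<integral>z. (norm (fst z - snd z))\<^sup>2 \<partial>\<pi>) \<le> c"
    using c by (auto simp: coupled_within_def)
  note m = couplings_marginals[OF \<pi>]
  have fb: "(\<lambda>x. real_of_ereal (f x)) \<in> borel_measurable borel"
    and fi: "integrable P (\<lambda>x. real_of_ereal (f x))" and fin: "AE x in P. \<bar>f x\<bar> \<noteq> \<infinity>"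
    using f P by (auto simp: L1_iff)
  have Fb: "(\<lambda>x. real_of_ereal (quad_env e f x)) \<in> borel_measurable borel"
    using quad_env_measurable by measurable
  have i1: "integrable \<pi> (\<lambda>z. real_of_ereal (f (fst z)))"
    and e1: "L1_integral P f = (\<integral>z. real_of_ereal (f (fst z)) \<partial>\<pi>)"
    using fi fb m(2) by (auto simp: L1_integral_def m(4) integrable_distr_eq integral_distr)
  have i2: "integrable \<pi> (\<lambda>z. (norm (snd z))\<^sup>2)"
    and e2: "(\<integral>x. (norm x)\<^sup>2 \<partial>P') = (\<integral>z. (norm (snd z))\<^sup>2 \<partial>\<pi>)"
    using P' m(3) by (auto simp: finite_second_moment_def m(5) integrable_distr_eq integral_distr)
  have i3: "integrable \<pi> (\<lambda>z. real_of_ereal (quad_env e f (snd z)))"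
    and e3: "L1_integral P' (quad_env e f) = (\<integral>z. real_of_ereal (quad_env e f (snd z)) \<partial>\<pi>)"
    using F(2) Fb m(3) by (auto simp: L1_integral_def m(5) integrable_distr_eq integral_distr)
  have "AE z in \<pi>. \<bar>f (fst z)\<bar> \<noteq> \<infinity>"
    using fin m(2) unfolding m(4) by (rule AE_distrD[rotated])
  then have "AE z in \<pi>. real_of_ereal (quad_env e f (snd z)) \<le>
      real_of_ereal (f (fst z)) + ((norm (fst z - snd z))\<^sup>2 / e + e * (norm (snd z))\<^sup>2)"
  proof eventually_elim
    case (elim z)
    have "quad_env e f (snd z) \<le> f (fst z) + ereal ((norm (fst z - snd z))\<^sup>2 / e + e * (norm (snd z))\<^sup>2)"
      unfolding quad_env_def by (rule INF_lower) simp
    with elim F(1)[of "snd z"] show ?case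
      by (cases "f (fst z)"; cases "quad_env e f (snd z)") auto
  qed
  then have "L1_integral P' (quad_env e f) \<le> (\<integral>z. real_of_ereal (f (fst z)) +
      ((norm (fst z - snd z))\<^sup>2 / e + e * (norm (snd z))\<^sup>2) \<partial>\<pi>)"
    unfolding e3 using i1 i2 i3 int by (intro integral_mono_AE) auto
  also have "\<dots> = L1_integral P f + (\<integral>z. (norm (fst z - snd z))\<^sup>2 \<partial>\<pi>) / e + e * (\<integral>x. (norm x)\<^sup>2 \<partial>P')"
    using i1 i2 int e1 e2 by simp
  also have "\<dots> \<le> L1_integral P f + c / e + e * (\<integral>x. (norm x)\<^sup>2 \<partial>P')"
    using c \<open>0 < e\<close> by (simp add: divide_right_mono)
  finally show ?thesis .
qed

text \<open>
  Near-minimizers \<open>u\<close> and \<open>w\<close> of the two infima reduce this to \<open>inner_perturbation\<close>.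
\<close>

lemma quad_env_pair_sum:
  assumes ge: "\<And>u w. ereal (u \<bullet> w) \<le> f u + g w" and e: "0 < e" "e \<le> 1 / 2"
    and fin: "\<And>x. \<bar>quad_env e f x\<bar> \<noteq> \<infinity>" "\<And>y. \<bar>quad_env e g y\<bar> \<noteq> \<infinity>"
  shows "ereal (x \<bullet> y) \<le> quad_env e f x + quad_env e g y"
proof (rule ccontr)
  assume "\<not> ?thesis"
  then have less: "quad_env e f x + quad_env e g y < ereal (x \<bullet> y)" by simp
  obtain F G where FG: "quad_env e f x = ereal F" "quad_env e g y = ereal G"
    using fin(1)[of x] fin(2)[of y] by auto
  define s where "s = (x \<bullet> y - (F + G)) / 2"
  have "0 < s" using less FG by (simp add: s_def)
  then have "quad_env e f x < ereal (F + s)" "quad_env e g y < ereal (G + s)" using FG by auto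
  then obtain u w where u: "f u + ereal ((norm (u - x))\<^sup>2 / e + e * (norm x)\<^sup>2) < ereal (F + s)"
      and w: "g w + ereal ((norm (w - y))\<^sup>2 / e + e * (norm y)\<^sup>2) < ereal (G + s)"
    unfolding quad_env_def INF_less_iff by auto
  have "F + s + (G + s) = x \<bullet> y" by (simp add: s_def field_simps)
  moreover have "0 \<le> ((norm (u - x))\<^sup>2 + (norm (w - y))\<^sup>2) / (2 * e)" using e by simp
  ultimately show False
    using u w ge[of u w] inner_perturbation[OF e, of x y u w]
    by (cases "f u"; cases "g w") auto
qed

text \<open>
  Near-minimizers \<open>u\<close> and \<open>w\<close> of the two infima again: as \<open>f u + g w\<close> is at least \<open>u \<bullet> w\<close>, the spare half
  of the penalty in \<open>inner_perturbation\<close> must be smaller than the slack \<open>d\<close>.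
\<close>

lemma quad_env_contact:
  assumes ge: "\<And>u w. ereal (u \<bullet> w) \<le> f u + g w" and e: "0 < e" "e \<le> 1 / 2"
    and fin: "\<And>x. \<bar>quad_env e f x\<bar> \<noteq> \<infinity>" "\<And>y. \<bar>quad_env e g y\<bar> \<noteq> \<infinity>"
    and less: "quad_env e f x + quad_env e g y < ereal (x \<bullet> y + d)"
  obtains u w where "(norm (u - x))\<^sup>2 \<le> 2 * e * d" "(norm (w - y))\<^sup>2 \<le> 2 * e * d"
    "f u + g w < ereal (u \<bullet> w + d)"
proof -
  obtain F G where FG: "quad_env e f x = ereal F" "quad_env e g y = ereal G"
    using fin(1)[of x] fin(2)[of y] by auto
  define s where "s = (x \<bullet> y + d - (F + G)) / 2"
  have "0 < s" using less FG by (simp add: s_def)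
  then have "quad_env e f x < ereal (F + s)" "quad_env e g y < ereal (G + s)" using FG by auto
  then obtain u w where u: "f u + ereal ((norm (u - x))\<^sup>2 / e + e * (norm x)\<^sup>2) < ereal (F + s)"
      and w: "g w + ereal ((norm (w - y))\<^sup>2 / e + e * (norm y)\<^sup>2) < ereal (G + s)"
    unfolding quad_env_def INF_less_iff by auto
  have sum: "F + s + (G + s) = x \<bullet> y + d" by (simp add: s_def field_simps)
  obtain a b where ab: "f u = ereal a" "g w = ereal b"
    using u w ge[of u w] by (cases "f u"; cases "g w") auto
  define A where "A = (norm (u - x))\<^sup>2"
  define B where "B = (norm (w - y))\<^sup>2"
  have AB0: "0 \<le> A" "0 \<le> B" by (auto simp: A_def B_def)
  have 1: "a + (A / e + e * (norm x)\<^sup>2) + (b + (B / e + e * (norm y)\<^sup>2)) < x \<bullet> y + d"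
    using u w ab sum by (simp add: A_def B_def)
  have 2: "x \<bullet> y + (A + B) / (2 * e) \<le>
      u \<bullet> w + (A / e + e * (norm x)\<^sup>2) + (B / e + e * (norm y)\<^sup>2)"
    using inner_perturbation[OF e, of x y u w] by (simp add: A_def B_def)
  have 3: "u \<bullet> w \<le> a + b" using ge[of u w] ab by simp
  have "(A + B) / (2 * e) < d" using 1 2 3 by linarith
  then have "A + B < 2 * e * d" using e by (simp add: field_simps)
  moreover have "0 \<le> (A + B) / (2 * e)" using e AB0 by simp
  then have "a + b < u \<bullet> w + d" using 1 2 by linarith
  ultimately have "A \<le> 2 * e * d" "B \<le> 2 * e * d" "f u + g w < ereal (u \<bullet> w + d)"
    using AB0 ab by auto
  then show thesis unfolding A_def B_def by (rule that)
qed

lemma quad_env_dual_pair: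
  fixes P Q P' Q' :: "'a::euclidean_space measure"
  assumes PQ: "borel_prob P" "borel_prob Q"
    and P': "borel_prob P'" "finite_second_moment P'" and Q': "borel_prob Q'" "finite_second_moment Q'"
    and pair: "(f, g) \<in> dual_pairs P Q"
    and c: "coupled_within c P P'" "coupled_within c Q Q'"
    and e: "0 < e" "e \<le> 1 / 2"
  shows "(quad_env e f, quad_env e g) \<in> dual_pairs P' Q'"
    and "dual_cost P' Q' (quad_env e f) (quad_env e g) \<le>
      dual_cost P Q f g + 2 * c / e + e * ((\<integral>x. (norm x)\<^sup>2 \<partial>P') + (\<integral>y. (norm y)\<^sup>2 \<partial>Q'))"
    and "\<bar>quad_env e f x\<bar> \<noteq> \<infinity>" and "\<bar>quad_env e g y\<bar> \<noteq> \<infinity>"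
proof -
  have prob: "prob_space P" "prob_space Q" using PQ by (auto simp: borel_prob_def)
  have e1: "e \<le> 1" using e by simp
  have L: "f \<in> L1 P" "g \<in> L1 Q" and ge: "\<And>x y. ereal (x \<bullet> y) \<le> f x + g y"
    using pair by (auto simp: dual_pairs_def)
  note F = quad_env_L1[OF prob pair P' e(1) e1]
  note G = quad_env_L1[OF prob(2,1) dual_pairs_swap[OF pair] Q' e(1) e1]
  show "\<bar>quad_env e f x\<bar> \<noteq> \<infinity>" "\<bar>quad_env e g y\<bar> \<noteq> \<infinity>" using F(1) G(1) by auto
  show "(quad_env e f, quad_env e g) \<in> dual_pairs P' Q'"
    using F(3) G(3) quad_env_pair_sum[OF ge e F(1) G(1)] by (simp add: dual_pairs_def)
  show "dual_cost P' Q' (quad_env e f) (quad_env e g) \<le>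
      dual_cost P Q f g + 2 * c / e + e * ((\<integral>x. (norm x)\<^sup>2 \<partial>P') + (\<integral>y. (norm y)\<^sup>2 \<partial>Q'))"
    using quad_env_integral_le[OF PQ(1) P'(2) c(1) L(1) e(1) F(1,2)]
      quad_env_integral_le[OF PQ(2) Q'(2) c(2) L(2) e(1) G(1,2)]
    by (simp add: dual_cost_def distrib_left)
qed

section \<open>Near-minimizers of the dual problem\<close>

text \<open>
  A conjugate is a supremum of continuous functions, hence lower semicontinuous.
\<close>

lemma conjugate_measurable:
  fixes m :: "'a::euclidean_space \<Rightarrow> ereal"
  assumes "\<And>x. m x \<noteq> -\<infinity>"
  shows "conjugate m \<in> borel_measurable borel"
proof (rule borel_measurableI_greater)
  fix a
  have "open {y. a < ereal (y \<bullet> x) - m x}" for x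
  proof (cases "m x")
    case (real r)
    then show ?thesis by (intro open_Collect_less) (auto intro!: continuous_intros)
  qed (use assms[of x] in auto)
  then have "open (\<Union>x. {y. a < ereal (y \<bullet> x) - m x})" by blast
  moreover have "{y \<in> space borel. a < conjugate m y} = (\<Union>x. {y. a < ereal (y \<bullet> x) - m x})"
    by (auto simp: conjugate_def less_SUP_iff)
  ultimately show "{y \<in> space borel. a < conjugate m y} \<in> sets borel" by simp
qed

text \<open>
  Integrability of the conjugate follows by squeezing it between the affine function
  \<open>\<lambda>y. y \<bullet> x0 - m x0\<close> at a point \<open>x0\<close> where \<open>m\<close> is finite and the integrable function \<open>k\<close>.
\<close>

lemma conjugate_dual_pair:
  fixes P Q :: "'a::euclidean_space measure"
  assumes P: "borel_prob P" and Q: "borel_prob Q" "finite_second_moment Q"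
    and m: "m \<in> L1 P" "\<And>x. m x \<noteq> -\<infinity>" and k: "k \<in> L1 Q"
    and ge: "\<And>x y. ereal (x \<bullet> y) \<le> m x + k y"
  shows "(m, conjugate m) \<in> dual_pairs P Q" and "conjugate m y \<le> k y"
proof -
  interpret P: prob_space P using P by (simp add: borel_prob_def)
  interpret Q: prob_space Q using Q by (simp add: borel_prob_def)
  have ge_k: "conjugate m y \<le> k y" for y
    unfolding conjugate_def
  proof (rule SUP_least)
    show "ereal (y \<bullet> x) - m x \<le> k y" for x
      using ge[of x y] m(2)[of x] by (cases "m x"; cases "k y") (auto simp: inner_commute)
  qed
  then show "conjugate m y \<le> k y" .
  obtain x0 where "\<bar>m x0\<bar> \<noteq> \<infinity>" using L1_finite_point[OF P.prob_space_axioms m(1)] .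
  then obtain c0 where c0: "m x0 = ereal c0" by auto
  have low: "ereal (y \<bullet> x) - m x \<le> conjugate m y" for x y
    unfolding conjugate_def by (rule SUP_upper) simp
  have k': "k \<in> borel_measurable borel" "integrable Q (\<lambda>y. real_of_ereal (k y))"
    "AE y in Q. \<bar>k y\<bar> \<noteq> \<infinity>"
    using k Q(1) by (auto simp: L1_iff)
  have hm: "conjugate m \<in> borel_measurable borel" using m(2) by (rule conjugate_measurable)
  have between: "AE y in Q. \<bar>conjugate m y\<bar> \<noteq> \<infinity> \<and> y \<bullet> x0 - c0 \<le> real_of_ereal (conjugate m y) \<and>
      real_of_ereal (conjugate m y) \<le> real_of_ereal (k y)"
    using k'(3)
  proof eventually_elim
    case (elim y)
    then show ?case using ge_k[of y] low[of y x0] c0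
      by (cases "k y"; cases "conjugate m y") auto
  qed
  have lin: "integrable Q (\<lambda>y. y \<bullet> x0 - c0)"
  proof (rule integrable_quadratic_growth[OF Q])
    show "\<bar>y \<bullet> x0 - c0\<bar> \<le> (1 + (norm x0)\<^sup>2 + \<bar>c0\<bar>) * (1 + (norm y)\<^sup>2)" for y
    proof -
      have "\<bar>y \<bullet> x0 - c0\<bar> \<le> (norm y)\<^sup>2 + (norm x0)\<^sup>2 + \<bar>c0\<bar>"
        using abs_inner_le_half_squares[of y x0] zero_le_power2[of "norm y"] zero_le_power2[of "norm x0"]
        by argo
      also have "\<dots> \<le> (1 + (norm x0)\<^sup>2 + \<bar>c0\<bar>) * (1 + (norm y)\<^sup>2)"
        by (simp add: algebra_simps add_nonneg_nonneg)
      finally show ?thesis .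
    qed
  qed (intro borel_measurable_continuous_onI continuous_intros)
  have "integrable Q (\<lambda>y. real_of_ereal (conjugate m y))"
  proof (rule Bochner_Integration.integrable_bound)
    show "integrable Q (\<lambda>y. \<bar>y \<bullet> x0 - c0\<bar> + \<bar>real_of_ereal (k y)\<bar>)"
      using lin k'(2) by (intro Bochner_Integration.integrable_add integrable_abs)
    show "AE y in Q. norm (real_of_ereal (conjugate m y)) \<le>
        norm (\<bar>y \<bullet> x0 - c0\<bar> + \<bar>real_of_ereal (k y)\<bar>)"
      using between
    proof eventually_elim
      case (elim y)
      then have "y \<bullet> x0 - c0 \<le> real_of_ereal (conjugate m y)"
        "real_of_ereal (conjugate m y) \<le> real_of_ereal (k y)" by auto
      then show ?case unfolding real_norm_def by linarith
    qed
  qed (use hm Q(1) in simp)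
  moreover have "AE y in Q. \<bar>conjugate m y\<bar> \<noteq> \<infinity>" using between by eventually_elim simp
  ultimately have "conjugate m \<in> L1 Q" using hm Q(1) by (simp add: L1_iff)
  moreover have "ereal (x \<bullet> y) \<le> m x + conjugate m y" for x y
    using low[of y x] m(2)[of x] by (cases "m x"; cases "conjugate m y") (auto simp: inner_commute)
  ultimately show "(m, conjugate m) \<in> dual_pairs P Q" using m(1) by (simp add: dual_pairs_def)
qed

text \<open>
  Let \<open>h\<close> be the conjugate of the mean \<open>m\<close> of \<open>F\<close> and \<open>\<phi>\<close>, and \<open>k\<close> the mean of \<open>G\<close> and \<open>\<psi>\<close>. As \<open>(m, h)\<close> is a
  dual pair, its cost is at least the minimum, so the integral of \<open>k - h \<ge> 0\<close> is at most half the excess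
  of \<open>(F, G)\<close>, and \<open>k - h\<close> cannot be at least \<open>d\<close> on all of \<open>B\<close>. Where \<open>k y - h y < d\<close>, a near-maximizer
  \<open>x\<close> in the definition of \<open>h y\<close> makes the sum of the two nonnegative defects \<open>F x + G y - x \<bullet> y\<close> and
  \<open>\<phi> x + \<psi> y - x \<bullet> y\<close> less than \<open>2 * d\<close>, hence each of them.
\<close>

lemma near_minimizers_touch_together:
  fixes P Q :: "'a::euclidean_space measure"
  assumes P: "borel_prob P" and Q: "borel_prob Q" "finite_second_moment Q"
    and pair: "(\<phi>, \<psi>) \<in> dual_pairs P Q"
    and opt: "\<And>f g. (f, g) \<in> dual_pairs P Q \<Longrightarrow> dual_cost P Q \<phi> \<psi> \<le> dual_cost P Q f g"
    and FG: "(F, G) \<in> dual_pairs P Q"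
    and B: "open B" and small: "dual_cost P Q F G < dual_cost P Q \<phi> \<psi> + 2 * d * measure Q B"
  obtains x y where "y \<in> B" "F x + G y < ereal (x \<bullet> y + 2 * d)" "\<phi> x + \<psi> y < ereal (x \<bullet> y + 2 * d)"
proof -
  interpret P: prob_space P using P by (simp add: borel_prob_def)
  interpret Q: prob_space Q using Q by (simp add: borel_prob_def)
  have L: "\<phi> \<in> L1 P" "\<psi> \<in> L1 Q" "F \<in> L1 P" "G \<in> L1 Q"
    and ge1: "\<And>x y. ereal (x \<bullet> y) \<le> \<phi> x + \<psi> y" and ge2: "\<And>x y. ereal (x \<bullet> y) \<le> F x + G y"
    using pair FG by (auto simp: dual_pairs_def)
  note noM = dual_pairs_not_MInf[OF P.prob_space_axioms Q.prob_space_axioms pair]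
    dual_pairs_not_MInf[OF P.prob_space_axioms Q.prob_space_axioms FG]
  define m where "m x = ereal (1 / 2) * (F x + \<phi> x)" for x
  define k where "k y = ereal (1 / 2) * (G y + \<psi> y)" for y
  have mL: "m \<in> L1 P" "L1_integral P m = (L1_integral P F + L1_integral P \<phi>) / 2"
    and kL: "k \<in> L1 Q" "L1_integral Q k = (L1_integral Q G + L1_integral Q \<psi>) / 2"
    unfolding m_def k_def using L1_mean L by auto
  have mM: "m x \<noteq> -\<infinity>" for x
    using noM(1,3)[of x] by (cases "F x"; cases "\<phi> x") (auto simp: m_def)
  have ge: "ereal (x \<bullet> y) \<le> m x + k y" for x y
    using ge1[of x y] ge2[of x y] noM(1,3)[of x] noM(2,4)[of y]
    by (cases "F x"; cases "\<phi> x"; cases "G y"; cases "\<psi> y") (auto simp: m_def k_def field_simps)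
  note hpair = conjugate_dual_pair(1)[OF P Q mL(1) mM kL(1) ge]
  note hk = conjugate_dual_pair(2)[OF P Q mL(1) mM kL(1) ge]
  define h where "h = conjugate m"
  have hL: "h \<in> L1 Q" using hpair by (simp add: dual_pairs_def h_def)
  define r where "r y = real_of_ereal (k y) - real_of_ereal (h y)" for y
  have rint: "integrable Q r"
    using kL(1) hL unfolding r_def by (auto simp: L1_iff)
  have "(\<integral>y. r y \<partial>Q) = L1_integral Q k - L1_integral Q h"
    unfolding r_def L1_integral_def using kL(1) hL by (auto simp: L1_iff)
  also have "L1_integral P m + L1_integral Q h \<ge> dual_cost P Q \<phi> \<psi>"
    using opt[OF hpair] by (simp add: dual_cost_def h_def)
  then have "L1_integral Q k - L1_integral Q h \<le> (dual_cost P Q F G - dual_cost P Q \<phi> \<psi>) / 2"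
    using mL(2) kL(2) by (simp add: dual_cost_def field_simps)
  also have "\<dots> < d * measure Q B" using small by simp
  finally have r_small: "(\<integral>y. r y \<partial>Q) < d * measure Q B" .
  have fin: "AE y in Q. \<bar>k y\<bar> \<noteq> \<infinity>" "AE y in Q. \<bar>h y\<bar> \<noteq> \<infinity>"
    using kL(1) hL by (auto simp: L1_iff)
  then have r0: "AE y in Q. 0 \<le> r y"
  proof eventually_elim
    case (elim y)
    then show ?case using hk[of y] by (cases "k y"; cases "h y") (auto simp: r_def h_def)
  qed
  have "\<exists>y\<in>B. \<bar>k y\<bar> \<noteq> \<infinity> \<and> \<bar>h y\<bar> \<noteq> \<infinity> \<and> r y < d"
  proof (rule ccontr)
    assume none: "\<not> ?thesis"
    have BQ: "B \<in> sets Q" using B Q by (simp add: borel_prob_def)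
    have "AE y in Q. d * indicator B y \<le> r y"
      using fin r0 by eventually_elim (use none in \<open>auto simp: indicator_def not_less\<close>)
    then have "(\<integral>y. d * indicator B y \<partial>Q) \<le> (\<integral>y. r y \<partial>Q)"
      using rint BQ
      by (intro integral_mono_AE integrable_mult_right integrable_real_indicator)
        (auto simp: Q.emeasure_eq_measure)
    then show False using r_small BQ by simp
  qed
  then obtain y where "y \<in> B" and "\<bar>k y\<bar> \<noteq> \<infinity> \<and> \<bar>h y\<bar> \<noteq> \<infinity> \<and> r y < d" ..
  then have y: "y \<in> B" "\<bar>k y\<bar> \<noteq> \<infinity>" "\<bar>h y\<bar> \<noteq> \<infinity>" "r y < d" by simp_all
  have "k y - ereal d < h y"
    using y(2-4) by (cases "k y"; cases "h y") (auto simp: r_def)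
  then obtain x where x: "k y - ereal d < ereal (y \<bullet> x) - m x"
    unfolding h_def conjugate_def less_SUP_iff by blast
  have "F x + G y < ereal (x \<bullet> y + 2 * d) \<and> \<phi> x + \<psi> y < ereal (x \<bullet> y + 2 * d)"
    using x y(2) ge1[of x y] ge2[of x y] noM(1,3)[of x] noM(2,4)[of y] inner_commute[of x y]
    by (cases "F x"; cases "\<phi> x"; cases "G y"; cases "\<psi> y")
       (auto simp: m_def k_def field_simps)
  with y(1) that show thesis by blast
qed

lemma optimal_potentialD:
  assumes "optimal_potential Q P \<psi>"
  shows "(conjugate \<psi>, \<psi>) \<in> dual_pairs P Q"
    and "(f, g) \<in> dual_pairs P Q \<Longrightarrow> dual_cost P Q (conjugate \<psi>) \<psi> \<le> dual_cost P Q f g"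
    and "convex_fun \<psi>"
  using assms by (auto simp: optimal_potential_def)

text \<open>
  The envelopes \<open>(F, G)\<close> of \<open>(conjugate \<psi>', \<psi>')\<close> form a near-minimizer for \<open>(P, Q)\<close>: their cost is compared
  with the minimal cost for \<open>(P', Q')\<close>, which in turn is at most the cost of the envelopes of
  \<open>(conjugate \<psi>, \<psi>)\<close>. Each of the two comparisons costs \<open>2 * c / e\<close> plus \<open>e\<close> times second moments, and the
  moments of \<open>P'\<close> and \<open>Q'\<close> are controlled by those of \<open>P\<close> and \<open>Q\<close>; this is the left-hand side of the last
  hypothesis. The right-hand side is the excess that \<open>near_minimizers_touch_together\<close> tolerates with
  \<open>d = r / 4\<close>.
\<close>

lemma nearby_potentials_share_subgradient:
  fixes P Q P' Q' :: "'a::euclidean_space measure"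
  assumes P: "borel_prob P" "finite_second_moment P" and Q: "borel_prob Q" "finite_second_moment Q"
    and P': "borel_prob P'" "finite_second_moment P'" and Q': "borel_prob Q'" "finite_second_moment Q'"
    and opt: "optimal_potential Q P \<psi>" and opt': "optimal_potential Q' P' \<psi>'"
    and fin: "\<And>z. z \<in> U \<Longrightarrow> \<psi> z = ereal (p z)" and "open U" "0 < r"
    and c: "coupled_within c P' P" "coupled_within c Q' Q" "c \<le> 1"
    and e: "0 < e" "e \<le> 1 / 2" "e \<le> r / 8"
    and small: "4 * c / e + e * (3 * ((\<integral>x. (norm x)\<^sup>2 \<partial>P) + (\<integral>y. (norm y)\<^sup>2 \<partial>Q)) + 4) <
      r / 2 * measure Q (ball y (r / 2) \<inter> U)"
  shows "share_subgradient_near \<psi>' p U r y"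
proof -
  have prob: "prob_space P" "prob_space Q" "prob_space P'" "prob_space Q'"
    using P Q P' Q' by (auto simp: borel_prob_def)
  note pair = optimal_potentialD(1)[OF opt] and pair' = optimal_potentialD(1)[OF opt']
  have ge: "\<And>x y. ereal (x \<bullet> y) \<le> conjugate \<psi> x + \<psi> y"
    and ge': "\<And>x y. ereal (x \<bullet> y) \<le> conjugate \<psi>' x + \<psi>' y"
    using pair pair' by (auto simp: dual_pairs_def)
  define B where "B = ball y (r / 2) \<inter> U"
  define M where "M = (\<integral>x. (norm x)\<^sup>2 \<partial>P) + (\<integral>y. (norm y)\<^sup>2 \<partial>Q)"
  define M' where "M' = (\<integral>x. (norm x)\<^sup>2 \<partial>P') + (\<integral>y. (norm y)\<^sup>2 \<partial>Q')"
  have "M' \<le> 2 * M + 4 * c"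
    using second_moment_coupled_le[OF P'(2) P(2) c(1)] second_moment_coupled_le[OF Q'(2) Q(2) c(2)]
    by (simp add: M_def M'_def)
  then have M': "e * M' \<le> e * (2 * M + 4)" using e c(3) by (intro mult_left_mono) auto
  define F G where "F = quad_env e (conjugate \<psi>')" and "G = quad_env e \<psi>'"
  note FG = quad_env_dual_pair[OF P'(1) Q'(1) P Q pair' c(1,2) e(1,2), folded F_def G_def M_def]
  note reg = quad_env_dual_pair[OF P(1) Q(1) P' Q' pair coupled_within_sym[OF c(1)]
      coupled_within_sym[OF c(2)] e(1,2), folded M'_def]
  have "dual_cost P Q F G \<le> dual_cost P' Q' (conjugate \<psi>') \<psi>' + 2 * c / e + e * M"
    by (rule FG(2))
  also have "dual_cost P' Q' (conjugate \<psi>') \<psi>' \<le>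
      dual_cost P' Q' (quad_env e (conjugate \<psi>)) (quad_env e \<psi>)"
    by (rule optimal_potentialD(2)[OF opt' reg(1)])
  also have "\<dots> \<le> dual_cost P Q (conjugate \<psi>) \<psi> + 2 * c / e + e * M'" by (rule reg(2))
  finally have "dual_cost P Q F G \<le> dual_cost P Q (conjugate \<psi>) \<psi> + 4 * c / e + e * M + e * M'"
    by simp
  also have "\<dots> < dual_cost P Q (conjugate \<psi>) \<psi> + 2 * (r / 4) * measure Q B"
    using small M' by (simp add: M_def[symmetric] B_def[symmetric] algebra_simps)
  finally have near: "dual_cost P Q F G < dual_cost P Q (conjugate \<psi>) \<psi> + 2 * (r / 4) * measure Q B" .
  have "open B" using \<open>open U\<close> by (auto simp: B_def)
  from near_minimizers_touch_together[OF P(1) Q pair optimal_potentialD(2)[OF opt] FG(1) this near]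
  obtain x v where v: "v \<in> B" and Fx: "F x + G v < ereal (x \<bullet> v + 2 * (r / 4))"
    and x: "conjugate \<psi> x + \<psi> v < ereal (x \<bullet> v + 2 * (r / 4))"
    by blast
  from quad_env_contact[OF ge' e(1,2) FG(3,4)[unfolded F_def G_def] Fx[unfolded F_def G_def]]
  obtain u w where ux: "(norm (u - x))\<^sup>2 \<le> 2 * e * (2 * (r / 4))"
    and wv: "(norm (w - v))\<^sup>2 \<le> 2 * e * (2 * (r / 4))"
    and u: "conjugate \<psi>' u + \<psi>' w < ereal (u \<bullet> w + 2 * (r / 4))"
    by blast
  (* Undoing the envelope moves the points by at most sqrt (e * r), which is less than r / 2. *)
  have close: "norm a < r / 2" if "(norm a)\<^sup>2 \<le> 2 * e * (2 * (r / 4))" for a :: 'a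
  proof -
    have "2 * e * (2 * (r / 4)) = e * r" by simp
    also have "\<dots> \<le> (r / 8) * r" using e \<open>0 < r\<close> by (intro mult_right_mono) auto
    also have "\<dots> < (r / 2)\<^sup>2" using \<open>0 < r\<close> by (simp add: power2_eq_square)
    finally have "(norm a)\<^sup>2 < (r / 2)\<^sup>2" using that by linarith
    then show ?thesis using \<open>0 < r\<close> by (intro power_less_imp_less_base[of "norm a" 2]) auto
  qed
  note ux' = close[OF ux] and wv' = close[OF wv]
  have vy: "norm (v - y) < r / 2" and "v \<in> U"
    using v by (auto simp: B_def dist_norm norm_minus_commute)
  have wy: "norm (w - y) < r" using norm_triangle_ineq[of "w - v" "v - y"] wv' vy by simp
  have noM: "conjugate \<psi>' u \<noteq> -\<infinity>" "\<psi>' w \<noteq> -\<infinity>" "conjugate \<psi> x \<noteq> -\<infinity>"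
    using dual_pairs_not_MInf[OF prob(3,4) pair'] dual_pairs_not_MInf[OF prob(1,2) pair] by auto
  obtain a b where ab: "conjugate \<psi>' u = ereal a" "\<psi>' w = ereal b"
    using u noM by (cases "conjugate \<psi>' u"; cases "\<psi>' w") auto
  (* Near-equality in the constraint at (u, w), together with the constraint at (u, z), says that u
     is an approximate subgradient at w; likewise for x at v. *)
  have sub': "ereal (b + u \<bullet> (z - w) - r) \<le> \<psi>' z" for z
    using ge'[of u z] u ab \<open>0 < r\<close> by (cases "\<psi>' z") (auto simp: inner_diff_right)
  have sub: "p v + x \<bullet> (z - v) - r \<le> p z" if "z \<in> U" for z
    using ge[of x z] x fin[OF that] fin[OF \<open>v \<in> U\<close>] noM(3) \<open>0 < r\<close>
    by (cases "conjugate \<psi> x") (auto simp: inner_diff_right)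
  show ?thesis
    unfolding share_subgradient_near_def
    using wy vy ux' ab(2) sub' sub \<open>0 < r\<close>
    by (intro exI[of _ w] exI[of _ v] exI[of _ u] exI[of _ x] exI[of _ b]) auto
qed

section \<open>The interior of the support\<close>

text \<open>
  By the Lindelof property countably many of the complements already cover the complement of the
  intersection.
\<close>

lemma Inter_closed_full_measure:
  fixes M :: "'a::euclidean_space measure"
  assumes M: "borel_prob M" and \<C>: "\<And>C. C \<in> \<C> \<Longrightarrow> closed C \<and> emeasure M C = 1"
  shows "emeasure M (\<Inter>\<C>) = 1"
proof -
  interpret prob_space M using M by (simp add: borel_prob_def)
  have sM: "sets M = sets borel" using M by (simp add: borel_prob_def)
  then have sp: "space M = UNIV" by (metis sets_eq_imp_space_eq space_borel)
  have "\<And>S. S \<in> uminus ` \<C> \<Longrightarrow> open S" using \<C> by auto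
  then obtain \<D> where \<D>: "\<D> \<subseteq> uminus ` \<C>" "countable \<D>" "\<Union>\<D> = \<Union>(uminus ` \<C>)"
    using Lindelof by metis
  have null: "D \<in> null_sets M" if "D \<in> \<D>" for D
  proof -
    have "D \<in> uminus ` \<C>" using that \<D>(1) by blast
    then obtain C where C: "C \<in> \<C>" "D = - C" by blast
    then have "C \<in> sets M" using \<C> sM by auto
    moreover have "prob C = 1" using \<C>[OF C(1)] by (simp add: measure_def)
    ultimately have "prob (space M - C) = 0" by (simp add: prob_compl)
    then have "emeasure M (- C) = 0"
      by (simp add: emeasure_eq_measure Compl_eq_Diff_UNIV sp)
    then show ?thesis using \<open>C \<in> sets M\<close> C(2) by (auto simp: null_sets_def sM)
  qed
  have "\<Union>\<D> \<in> null_sets M" by (rule null_sets_UN'[OF \<D>(2) null, of id, simplified])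
  then have N: "- \<Inter>\<C> \<in> null_sets M" by (simp add: \<D>(3) uminus_Inf)
  have "emeasure M (space M - (- \<Inter>\<C>)) = emeasure M (space M)"
    using N by (rule emeasure_Diff_null_set) auto
  then show ?thesis by (simp add: sp emeasure_space_1[unfolded sp] Diff_eq)
qed

text \<open>
  The convex support \<open>K\<close> has full measure and, being convex, a Lebesgue-null boundary, so its interior
  has full measure. A nonempty open subset of \<open>interior K\<close> has positive measure because the density is
  positive there; therefore every closed set of full measure contains \<open>interior K\<close>. Thus the support
  lies between \<open>interior K\<close> and \<open>K\<close>, and its interior is that of \<open>K\<close>.
\<close>

lemma interior_support_positive_density:
  fixes Q :: "'a::euclidean_space measure"
  assumes Q: "borel_prob Q" and dens: "has_positive_density Q"
  shows "convex (interior (measure_support Q))"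
    and "AE x in Q. x \<in> interior (measure_support Q)"
    and "\<And>B. open B \<Longrightarrow> B \<noteq> {} \<Longrightarrow> B \<subseteq> interior (measure_support Q) \<Longrightarrow> 0 < measure Q B"
proof -
  interpret prob_space Q using Q by (simp add: borel_prob_def)
  have sQ: "sets Q = sets borel" using Q by (simp add: borel_prob_def)
  obtain f where [measurable]: "f \<in> borel_measurable lborel" and f0: "\<And>x. 0 \<le> f x"
    and Qf: "Q = density lborel (\<lambda>x. ennreal (f x))"
    and fpos: "\<And>x. x \<in> interior (convex_support Q) \<Longrightarrow> 0 < f x"
    using dens by (auto simp: has_positive_density_def)
  define K where "K = convex_support Q"
  have "closed K" "convex K"
    unfolding K_def convex_support_def by (auto intro!: closed_Inter convex_Inter)
  have "emeasure Q K = 1"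
    unfolding K_def convex_support_def by (rule Inter_closed_full_measure[OF Q]) auto
  then have "prob K = 1" by (simp add: measure_def)
  then have "AE x in Q. x \<in> K"
    using \<open>closed K\<close> sQ by (subst AE_in_set_eq_1) auto
  moreover have "AE x in Q. x \<notin> frontier K"
  proof -
    have "frontier K \<in> null_sets (completion lborel)"
      using negligible_convex_frontier[OF \<open>convex K\<close>] by (simp only: negligible_iff_null_sets)
    then have "frontier K \<in> null_sets lborel"
      by (subst (asm) null_sets_completion_iff) auto
    then have "AE x in lborel. x \<notin> frontier K" by (rule AE_not_in)
    then show ?thesis unfolding Qf by (subst AE_density) auto
  qed
  ultimately have AEK: "AE x in Q. x \<in> interior K"
    by eventually_elim (use \<open>closed K\<close> in \<open>auto simp: frontier_def closure_closed\<close>)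
  have pos: "0 < measure Q B" if B: "open B" "B \<noteq> {}" "B \<subseteq> interior K" for B
  proof (rule ccontr)
    assume "\<not> 0 < measure Q B"
    then have "emeasure Q B = 0" by (simp add: emeasure_eq_measure zero_less_measure_iff)
    moreover have "B \<in> sets lborel" using B by simp
    ultimately have "B \<in> null_sets Q" using sQ by (auto simp: null_sets_def)
    then have "AE x in lborel. x \<in> B \<longrightarrow> ennreal (f x) = 0"
      unfolding Qf by (subst (asm) null_sets_density_iff) auto
    then have "AE x in lborel. x \<notin> B"
    proof eventually_elim
      case (elim x)
      then show ?case using fpos[of x] B(3) f0[of x] by (auto simp: K_def ennreal_eq_0_iff)
    qed
    then have "emeasure lborel B = 0"
      using \<open>B \<in> sets lborel\<close> by (subst (asm) AE_iff_measurable[of B]) auto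
    then have "negligible B"
      using \<open>B \<in> sets lborel\<close> by (simp add: negligible_iff_emeasure0)
    then show False using open_not_negligible B by blast
  qed
  have "interior K \<subseteq> C" if "closed C" "emeasure Q C = 1" for C
  proof (rule ccontr)
    assume "\<not> interior K \<subseteq> C"
    then have "0 < measure Q (interior K - C)" using that by (intro pos) auto
    moreover have "C \<in> sets Q" using that sQ by simp
    moreover have "prob (interior K - C) \<le> prob (space Q - C)"
      using \<open>C \<in> sets Q\<close> sets_eq_imp_space_eq[OF sQ]
      by (intro finite_measure_mono) (auto simp: sQ)
    moreover have "prob C = 1" using that by (simp add: measure_def)
    ultimately show False by (simp add: prob_compl)
  qed
  then have "interior K \<subseteq> measure_support Q" by (auto simp: measure_support_def)
  moreover have "measure_support Q \<subseteq> K"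
    by (auto simp: measure_support_def K_def convex_support_def)
  ultimately have eq: "interior (measure_support Q) = interior K"
    by (metis interior_maximal interior_mono open_interior subset_antisym)
  show "convex (interior (measure_support Q))" using \<open>convex K\<close> eq by simp
  show "AE x in Q. x \<in> interior (measure_support Q)" using AEK eq by simp
  show "0 < measure Q B" if "open B" "B \<noteq> {}" "B \<subseteq> interior (measure_support Q)" for B
    using pos that eq by simp
qed

text \<open>
  The set where \<open>f\<close> is finite is convex and dense in \<open>U\<close>, and a convex set has the same interior as its
  closure.
\<close>

lemma convex_fun_finite_on_interior_support:
  fixes Q :: "'a::euclidean_space measure"
  assumes "open U" and pos: "\<And>B. open B \<Longrightarrow> B \<noteq> {} \<Longrightarrow> B \<subseteq> U \<Longrightarrow> 0 < measure Q B"
    and fin: "AE x in Q. f x \<noteq> \<infinity>" and conv: "convex_fun f" and sQ: "sets Q = sets borel"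
    and "y \<in> U"
  shows "f y \<noteq> \<infinity>"
proof -
  define D where "D = {z. f z \<noteq> \<infinity>}"
  have "convex D" using convex_finite_domain[OF conv] by (simp add: D_def)
  have "B \<inter> D \<noteq> {}" if B: "open B" "B \<noteq> {}" "B \<subseteq> U" for B
  proof
    assume "B \<inter> D = {}"
    have "AE x in Q. x \<notin> B"
      using fin by eventually_elim (use \<open>B \<inter> D = {}\<close> in \<open>auto simp: D_def\<close>)
    then have "B \<in> null_sets Q" using B(1) sQ by (subst AE_iff_null_sets) auto
    then have "measure Q B = 0" by (simp add: measure_eq_0_null_sets)
    with pos[OF B] show False by simp
  qed
  from this[of "U - closure D"] have "U \<subseteq> closure D"
    using \<open>open U\<close> closure_subset[of D] by blast
  then have "U \<subseteq> interior (closure D)" using \<open>open U\<close> by (simp add: interior_maximal)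
  also have "\<dots> = interior D" using \<open>convex D\<close> by (rule convex_interior_closure)
  finally have "y \<in> D" using \<open>y \<in> U\<close> interior_subset by blast
  then show ?thesis by (simp add: D_def)
qed

section \<open>Convergence of the potentials\<close>

theorem theorem2p8:
  fixes P Q :: "'a::euclidean_space measure"
    and Pn Qn :: "nat \<Rightarrow> 'a measure"
    and \<psi> :: "'a \<Rightarrow> ereal"
    and \<psi>n :: "nat \<Rightarrow> 'a \<Rightarrow> ereal"
  assumes "borel_prob P" "finite_second_moment P"
    and "borel_prob Q" "finite_second_moment Q"
    and "\<And>n. n \<ge> 1 \<Longrightarrow> borel_prob (Pn n)" "\<And>n. n \<ge> 1 \<Longrightarrow> finite_second_moment (Pn n)"
    and "\<And>n. n \<ge> 1 \<Longrightarrow> borel_prob (Qn n)" "\<And>n. n \<ge> 1 \<Longrightarrow> finite_second_moment (Qn n)"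
    and "has_positive_density Q"
    and "(\<lambda>n. wasserstein2 (Pn n) P) \<longlonglongrightarrow> 0"
    and "(\<lambda>n. wasserstein2 (Qn n) Q) \<longlonglongrightarrow> 0"
    and "\<And>n. n \<ge> 1 \<Longrightarrow> optimal_potential (Qn n) (Pn n) (\<psi>n n)"
    and "optimal_potential Q P \<psi>"
  shows "\<exists>a :: nat \<Rightarrow> real.
    (\<forall>x\<in>interior (measure_support Q). (\<lambda>n. \<psi>n n x - ereal (a n)) \<longlonglongrightarrow> \<psi> x) \<and>
    (AE x in Q. (\<lambda>n. \<psi>n n x - ereal (a n)) \<longlonglongrightarrow> \<psi> x)"
proof -
  note P = assms(1,2) and Q = assms(3,4) and opt = assms(13)
  define U where "U = interior (measure_support Q)"
  note supp = interior_support_positive_density[OF Q(1) assms(9), folded U_def]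
  have "open U" by (simp add: U_def)
  have prob: "prob_space P" "prob_space Q" and sQ: "sets Q = sets borel"
    using P Q by (auto simp: borel_prob_def)
  note pair = optimal_potentialD(1)[OF opt] and conv = optimal_potentialD(3)[OF opt]
  define p where "p z = real_of_ereal (\<psi> z)" for z
  have "AE z in Q. \<bar>\<psi> z\<bar> \<noteq> \<infinity>" using pair by (simp add: dual_pairs_def L1_iff)
  then have "AE z in Q. \<psi> z \<noteq> \<infinity>" by eventually_elim auto
  then have p: "\<psi> z = ereal (p z)" if "z \<in> U" for z
    using convex_fun_finite_on_interior_support[OF \<open>open U\<close> supp(3) _ conv sQ that]
      dual_pairs_not_MInf(2)[OF prob pair, of z]
    by (cases "\<psi> z") (auto simp: p_def)
  have "convex_on U p" using conv supp(1) p by (rule convex_on_real_of_convex_fun)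
  with \<open>open U\<close> have cont: "continuous_on U p" by (rule convex_on_continuous)
  have share: "\<forall>\<^sub>F n in sequentially. share_subgradient_near (\<psi>n n) p U r y"
    if y: "y \<in> U" and "0 < r" for y r
  proof -
    define M where "M = (\<integral>x. (norm x)\<^sup>2 \<partial>P) + (\<integral>y. (norm y)\<^sup>2 \<partial>Q)"
    have "0 \<le> M" by (simp add: M_def)
    define t where "t = r / 2 * measure Q (ball y (r / 2) \<inter> U)"
    have "y \<in> ball y (r / 2) \<inter> U" using y \<open>0 < r\<close> by simp
    then have "0 < measure Q (ball y (r / 2) \<inter> U)" using \<open>open U\<close> by (intro supp(3)) blast+
    then have "0 < t" using \<open>0 < r\<close> by (simp add: t_def)
    (* With M the sum of the second moments, the error is 4 * c / e + e * (3 * M + 4). First e makes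
       the second summand at most t / 4, then c, the bound on the transport cost, does the same for
       the first. *)
    define e where "e = min (1 / 2) (min (r / 8) (t / 4 / (3 * M + 4)))"
    have e: "0 < e" "e \<le> 1 / 2" "e \<le> r / 8" "e \<le> t / 4 / (3 * M + 4)"
      using \<open>0 < r\<close> \<open>0 < t\<close> \<open>0 \<le> M\<close> 
      by (simp add: e_def, simp_all only: e_def min.cobounded1 min.coboundedI2)
    define c where "c = min 1 (e * t / 16)"
    have c: "0 < c" "c \<le> 1" "c \<le> e * t / 16" using e(1) \<open>0 < t\<close> by (auto simp: c_def)
    have "4 * c / e \<le> t / 4" using c(3) e(1) by (simp add: field_simps)
    moreover have "e * (3 * M + 4) \<le> t / 4" using e(4) \<open>0 \<le> M\<close> by (simp add: field_simps)
    ultimately have small: "4 * c / e + e * (3 * M + 4) < t" using \<open>0 < t\<close> by linarith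
    have "0 < sqrt c" using c by simp
    have "\<forall>\<^sub>F n in sequentially. wasserstein2 (Pn n) P < sqrt c"
      by (rule order_tendstoD(2)[OF assms(10) \<open>0 < sqrt c\<close>])
    moreover have "\<forall>\<^sub>F n in sequentially. wasserstein2 (Qn n) Q < sqrt c"
      by (rule order_tendstoD(2)[OF assms(11) \<open>0 < sqrt c\<close>])
    ultimately show ?thesis
      using eventually_ge_at_top[of "1::nat"]
    proof eventually_elim
      case (elim n)
      note P' = assms(5,6)[OF elim(3)] and Q' = assms(7,8)[OF elim(3)]
      show ?case
        using nearby_potentials_share_subgradient[OF P Q P' Q' opt assms(12)[OF elim(3)] p
            \<open>open U\<close> \<open>0 < r\<close> coupled_within_if_wasserstein2_less[OF P' P elim(1)]
            coupled_within_if_wasserstein2_less[OF Q' Q elim(2)] c(2) e(1-3)]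
          small by (simp add: M_def t_def)
    qed
  qed
  have "\<forall>\<^sub>F n in sequentially. convex_fun (\<psi>n n)"
    using eventually_ge_at_top[of "1::nat"]
    by eventually_elim (rule optimal_potentialD(3)[OF assms(12)])
  from convergence_from_shared_subgradients[OF \<open>open U\<close> supp(1) cont this share]
  obtain a where a: "\<And>x. x \<in> U \<Longrightarrow> (\<lambda>n. \<psi>n n x - ereal (a n)) \<longlonglongrightarrow> \<psi> x"
    using p by auto
  moreover have "AE x in Q. (\<lambda>n. \<psi>n n x - ereal (a n)) \<longlonglongrightarrow> \<psi> x"
    using supp(2) by eventually_elim (rule a)
  ultimately show ?thesis unfolding U_def by blast
qed

end
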